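(* Let $(V_0^*,\Phi,V_0,\Phi^\vee)$ be a real root system with finite Weyl group $W$, let $V=\mathbb C\otimes_{\mathbb R}V_0$ with its $W$-invariant symmetric form $B$, and let $k:\Phi\to\mathbb C$ be a $W$-invariant parameter function. Then the element $$\nu'(\Omega'_W)=\frac1{16}\sum_{\alpha,\beta>0}k_\alpha k_\beta\frac1{B(\alpha^\vee,\beta^\vee)}\,\nu'([s_\alpha,s_\beta])^2$$ is an $O(V,B)$-invariant element of the Weyl algebra $\mathcal W(V\oplus V^*,\omega)$.
   Context: $V_0$ is a finite-dimensional real vector space, $\Phi\subset V_0^*$ the roots, $\Phi^\vee\subset V_0$ the coroots $\alpha^\vee$, $W$ is generated by the reflections $s_\alpha(v)=v-\alpha(v)\alpha^\vee$, and $B$ is a positive-definite $W$-invariant symmetric bilinear form on $V_0$, extended complex-bilinearly to $V$. Fix positive roots; $\alpha>0$ means $\alpha$ is positive. $\mathcal W(V\oplus V^*,\omega)$ is the Weyl algebra: the quotient of the tensor algebra of $V\oplus V^*$ by $vw-wv=\omega(v,w)$, where $V,V^*$ are isotropic and $\omega(\lambda,v)=\lambda(v)$ for $\lambda\in V^*,v\in V$. $O(V,B)$ acts on $V\oplus V^*$ by $g(v,\lambda)=(gv,\lambda\circ g^{-1})$, preserving $\omega$, hence acts on $\mathcal W(V\oplus V^*,\omega)$ by algebra automorphisms. $\nu':\mathfrak{so}(V,B)\to\mathcal W(V\oplus V^*,\omega)$ is $\nu'(f)=\sum_if(v_i)v_i^*$ for a basis $\{v_i\}$ of $V$ with dual basis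 $\{v_i^*\}$ of $V^*$; the commutator $[s_\alpha,s_\beta]=s_\alpha s_\beta-s_\beta s_\alpha$ is regarded as an element of $\mathfrak{so}(V,B)$. Pairs with $B(\alpha^\vee,\beta^\vee)=0$ (for which $[s_\alpha,s_\beta]=0$) contribute $0$. Here $\Omega'_W=\frac1{16}\sum_{\alpha,\beta>0}k_\alpha k_\beta B(\alpha^\vee,\beta^\vee)^{-1}[s_\alpha,s_\beta]^2$.
   Formalization: The root system is assumed irreducible with roots spanning V_0^*. Without this the claim fails: for A2×A2 in R^4 with k=1 the element is a nonzero multiple of M_12²+M_34² (M_ij = x_i∂_j − x_j∂_i), not O(4)-invariant. Excluded cases where it holds have element 0. *)

theory Defs
  imports "HOL-Analysis.Analysis" "HOL-Library.Poly_Mapping"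
begin

section \<open>Root systems on \<open>V\<^sub>0\<close>\<close>

text \<open>
  \<open>V\<^sub>0\<close> is \<^typ>\<open>real ^ 'n\<close>, elements of \<open>V\<^sub>0\<^sup>*\<close> are linear functions into the reals, and the
  coroots are given by the map \<open>\<alpha> \<mapsto> \<alpha>\<^sup>\<or>\<close>, whose values off \<open>\<Phi>\<close> are irrelevant.  Neither the
  crystallographic condition nor reducedness is imposed.
\<close>

definition reflection ::
  "((real ^ 'n \<Rightarrow> real) \<Rightarrow> real ^ 'n) \<Rightarrow> (real ^ 'n \<Rightarrow> real) \<Rightarrow> real ^ 'n \<Rightarrow> real ^ 'n" where
  "reflection coroot \<alpha> v = v - \<alpha> v *\<^sub>R coroot \<alpha>"

definition root_system ::
  "(real ^ 'n \<Rightarrow> real) set \<Rightarrow> ((real ^ 'n \<Rightarrow> real) \<Rightarrow> real ^ 'n) \<Rightarrow> bool" where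
  "root_system \<Phi> coroot \<longleftrightarrow>
     finite \<Phi> \<and> (\<forall>\<alpha>\<in>\<Phi>. linear \<alpha>) \<and>
     (\<forall>f. linear f \<longrightarrow> (\<exists>c. f = (\<lambda>v. \<Sum>\<alpha>\<in>\<Phi>. c \<alpha> * \<alpha> v))) \<and>
     (\<forall>\<alpha>\<in>\<Phi>. \<alpha> (coroot \<alpha>) = 2) \<and>
     (\<forall>\<alpha>\<in>\<Phi>. \<forall>\<beta>\<in>\<Phi>. \<beta> \<circ> reflection coroot \<alpha> \<in> \<Phi>) \<and>
     (\<forall>\<alpha>\<in>\<Phi>. \<forall>\<beta>\<in>\<Phi>. reflection coroot \<alpha> (coroot \<beta>) \<in> coroot ` \<Phi>)"

text \<open>
  Irreducibility is what makes the invariant form essentially unique.  For \<open>\<Phi>\<close> of type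
  \<open>B\<^sub>2 \<times> B\<^sub>2\<close> with \<open>k = 1\<close> the element \<open>\<nu>'(\<Omega>'\<^sub>W)\<close> below is a nonzero multiple of
  \<open>M\<^sub>1\<^sub>2\<^sup>2 + M\<^sub>3\<^sub>4\<^sup>2\<close>, where \<open>M\<^sub>i\<^sub>j = x\<^sub>i \<partial>\<^sub>j - x\<^sub>j \<partial>\<^sub>i\<close>, and is not \<open>O(4)\<close>-invariant.
\<close>

definition irreducible_roots ::
  "(real ^ 'n \<Rightarrow> real) set \<Rightarrow> ((real ^ 'n \<Rightarrow> real) \<Rightarrow> real ^ 'n) \<Rightarrow> bool" where
  "irreducible_roots \<Phi> coroot \<longleftrightarrow>
     \<not> (\<exists>\<Phi>1 \<Phi>2. \<Phi>1 \<noteq> {} \<and> \<Phi>2 \<noteq> {} \<and> \<Phi>1 \<union> \<Phi>2 = \<Phi> \<and> \<Phi>1 \<inter> \<Phi>2 = {} \<and>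
          (\<forall>\<alpha>\<in>\<Phi>1. \<forall>\<beta>\<in>\<Phi>2. \<alpha> (coroot \<beta>) = 0 \<and> \<beta> (coroot \<alpha>) = 0))"

text \<open>Reflections are involutions, so the monoid they generate is the group they generate.\<close>

inductive_set weyl_group ::
  "(real ^ 'n \<Rightarrow> real) set \<Rightarrow> ((real ^ 'n \<Rightarrow> real) \<Rightarrow> real ^ 'n) \<Rightarrow> (real ^ 'n \<Rightarrow> real ^ 'n) set"
  for \<Phi> :: "(real ^ 'n \<Rightarrow> real) set" and coroot :: "(real ^ 'n \<Rightarrow> real) \<Rightarrow> real ^ 'n"
where
  id: "id \<in> weyl_group \<Phi> coroot"
| step: "\<alpha> \<in> \<Phi> \<Longrightarrow> w \<in> weyl_group \<Phi> coroot \<Longrightarrow> reflection coroot \<alpha> \<circ> w \<in> weyl_group \<Phi> coroot"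

definition positive_system :: "(real ^ 'n \<Rightarrow> real) set \<Rightarrow> (real ^ 'n \<Rightarrow> real) set \<Rightarrow> bool" where
  "positive_system \<Phi> P \<longleftrightarrow> (\<exists>x. (\<forall>\<alpha>\<in>\<Phi>. \<alpha> x \<noteq> 0) \<and> P = {\<alpha>\<in>\<Phi>. \<alpha> x > 0})"

definition invariant_form ::
  "(real ^ 'n \<Rightarrow> real) set \<Rightarrow> ((real ^ 'n \<Rightarrow> real) \<Rightarrow> real ^ 'n) \<Rightarrow>
   (real ^ 'n \<Rightarrow> real ^ 'n \<Rightarrow> real) \<Rightarrow> bool" where
  "invariant_form \<Phi> coroot B \<longleftrightarrow>
     bilinear B \<and> (\<forall>v w. B v w = B w v) \<and> (\<forall>v. v \<noteq> 0 \<longrightarrow> B v v > 0) \<and>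
     (\<forall>g\<in>weyl_group \<Phi> coroot. \<forall>v w. B (g v) (g w) = B v w)"

text \<open>\<open>w\<alpha> = \<alpha> \<circ> w\<^sup>-\<^sup>1\<close> is the action of \<open>W\<close> on \<open>V\<^sub>0\<^sup>*\<close>.\<close>

definition invariant_parameter ::
  "(real ^ 'n \<Rightarrow> real) set \<Rightarrow> ((real ^ 'n \<Rightarrow> real) \<Rightarrow> real ^ 'n) \<Rightarrow>
   ((real ^ 'n \<Rightarrow> real) \<Rightarrow> complex) \<Rightarrow> bool" where
  "invariant_parameter \<Phi> coroot k \<longleftrightarrow>
     (\<forall>w\<in>weyl_group \<Phi> coroot. \<forall>\<alpha>\<in>\<Phi>. k (\<alpha> \<circ> inv w) = k \<alpha>)"


section \<open>Complexification\<close>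

text \<open>\<open>V = \<complex> \<otimes> V\<^sub>0\<close> is \<^typ>\<open>complex ^ 'n\<close>, with \<open>v = Re v + \<i> Im v\<close> taken componentwise.\<close>

definition Re_vec :: "complex ^ 'n \<Rightarrow> real ^ 'n" where
  "Re_vec v = (\<chi> i. Re (v $ i))"

definition Im_vec :: "complex ^ 'n \<Rightarrow> real ^ 'n" where
  "Im_vec v = (\<chi> i. Im (v $ i))"

definition of_real_vec :: "real ^ 'n \<Rightarrow> complex ^ 'n" where
  "of_real_vec v = (\<chi> i. complex_of_real (v $ i))"

definition functional_ext :: "(real ^ 'n \<Rightarrow> real) \<Rightarrow> complex ^ 'n \<Rightarrow> complex" where
  "functional_ext \<alpha> v = Complex (\<alpha> (Re_vec v)) (\<alpha> (Im_vec v))"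

definition form_ext ::
  "(real ^ 'n \<Rightarrow> real ^ 'n \<Rightarrow> real) \<Rightarrow> complex ^ 'n \<Rightarrow> complex ^ 'n \<Rightarrow> complex" where
  "form_ext B v w =
     Complex (B (Re_vec v) (Re_vec w) - B (Im_vec v) (Im_vec w))
             (B (Re_vec v) (Im_vec w) + B (Im_vec v) (Re_vec w))"

definition reflection_ext ::
  "((real ^ 'n \<Rightarrow> real) \<Rightarrow> real ^ 'n) \<Rightarrow> (real ^ 'n \<Rightarrow> real) \<Rightarrow> complex ^ 'n \<Rightarrow> complex ^ 'n" where
  "reflection_ext coroot \<alpha> v = v - functional_ext \<alpha> v *s of_real_vec (coroot \<alpha>)"

definition commutator ::
  "(complex ^ 'n \<Rightarrow> complex ^ 'n) \<Rightarrow> (complex ^ 'n \<Rightarrow> complex ^ 'n) \<Rightarrow> complex ^ 'n \<Rightarrow> complex ^ 'n" where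
  "commutator f g v = f (g v) - g (f v)"

definition orthogonal_group ::
  "(real ^ 'n \<Rightarrow> real ^ 'n \<Rightarrow> real) \<Rightarrow> (complex ^ 'n ^ 'n) set" where
  "orthogonal_group B =
     {g. invertible g \<and> (\<forall>v w. form_ext B (g *v v) (g *v w) = form_ext B v w)}"


section \<open>The dual space and the symplectic space\<close>

lemma linear_complex_iff:
  fixes f :: "complex ^ 'n \<Rightarrow> complex"
  shows "Vector_Spaces.linear (*s) (*) f \<longleftrightarrow>
    (\<forall>v w. f (v + w) = f v + f w) \<and> (\<forall>c v. f (c *s v) = c * f v)"
  by (auto simp: Vector_Spaces.linear_iff vector_space_over_itself.vector_space_axioms
      vec.vector_space_axioms)

typedef (overloaded) ('n :: finite) cdual =
  "{f :: complex ^ 'n \<Rightarrow> complex. Vector_Spaces.linear (*s) (*) f}"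
  morphisms cdual_apply Abs_cdual
  by (rule exI[of _ "\<lambda>_. 0"]) (simp add: linear_complex_iff)

setup_lifting type_definition_cdual

instantiation cdual :: (finite) ab_group_add
begin

lift_definition zero_cdual :: "'a cdual" is "\<lambda>_. 0"
  by (simp add: linear_complex_iff)
lift_definition plus_cdual :: "'a cdual \<Rightarrow> 'a cdual \<Rightarrow> 'a cdual" is "\<lambda>f g v. f v + g v"
  by (simp add: linear_complex_iff algebra_simps)
lift_definition minus_cdual :: "'a cdual \<Rightarrow> 'a cdual \<Rightarrow> 'a cdual" is "\<lambda>f g v. f v - g v"
  by (simp add: linear_complex_iff algebra_simps)
lift_definition uminus_cdual :: "'a cdual \<Rightarrow> 'a cdual" is "\<lambda>f v. - f v"
  by (simp add: linear_complex_iff algebra_simps)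

instance by standard (transfer; simp add: fun_eq_iff)+

end

lift_definition cdual_scale :: "complex \<Rightarrow> ('n :: finite) cdual \<Rightarrow> 'n cdual" is "\<lambda>c f v. c * f v"
  by (simp add: linear_complex_iff algebra_simps)

lift_definition cdual_comp :: "('n :: finite) cdual \<Rightarrow> complex ^ 'n ^ 'n \<Rightarrow> 'n cdual"
  is "\<lambda>f A v. f (A *v v)"
  by (simp add: linear_complex_iff matrix_vector_right_distrib vector_scalar_commute)

lift_definition coord :: "'n \<Rightarrow> ('n :: finite) cdual" is "\<lambda>i v. v $ i"
  by (simp add: linear_complex_iff)

type_synonym 'n phase = "(complex ^ 'n) \<times> 'n cdual"

definition phase_scale :: "complex \<Rightarrow> ('n :: finite) phase \<Rightarrow> 'n phase" where
  "phase_scale c u = (c *s fst u, cdual_scale c (snd u))"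

definition symplectic :: "('n :: finite) phase \<Rightarrow> 'n phase \<Rightarrow> complex" where
  "symplectic u u' = cdual_apply (snd u) (fst u') - cdual_apply (snd u') (fst u)"

definition phase_act :: "complex ^ 'n ^ 'n \<Rightarrow> ('n :: finite) phase \<Rightarrow> 'n phase" where
  "phase_act g u = (g *v fst u, cdual_comp (snd u) (matrix_inv g))"


section \<open>The Weyl algebra\<close>

text \<open>The free monoid, written additively so that \<open>'a fmon \<Rightarrow>\<^sub>0 complex\<close> carries the
  convolution product and is the free associative algebra on the set \<open>'a\<close>.\<close>

datatype 'a fmon = FMon (letters: "'a list")

instantiation fmon :: (type) monoid_add
begin
definition "0 = FMon []"
definition "x + y = FMon (letters x @ letters y)"
instance by standard (simp_all add: zero_fmon_def plus_fmon_def)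
end

definition free_scalar :: "complex \<Rightarrow> ('a fmon \<Rightarrow>\<^sub>0 complex)" where
  "free_scalar c = Poly_Mapping.single 0 c"

definition free_gen :: "'a \<Rightarrow> ('a fmon \<Rightarrow>\<^sub>0 complex)" where
  "free_gen u = Poly_Mapping.single (FMon [u]) 1"

text \<open>
  The tensor algebra of \<open>U = V \<oplus> V\<^sup>*\<close> is the free algebra on the underlying set of \<open>U\<close> modulo the
  linearity relations (\<open>add\<close>, \<open>scale\<close>), so the Weyl algebra is the quotient of that free algebra by
  the two-sided ideal generated by these together with the commutation relations (\<open>comm\<close>).
\<close>

inductive_set weyl_ideal :: "(('n :: finite) phase fmon \<Rightarrow>\<^sub>0 complex) set" where
  add: "free_gen (u + u') - (free_gen u + free_gen u') \<in> weyl_ideal"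
| scale: "free_gen (phase_scale c u) - free_scalar c * free_gen u \<in> weyl_ideal"
| comm: "free_gen u * free_gen u' - free_gen u' * free_gen u - free_scalar (symplectic u u') \<in> weyl_ideal"
| zero: "0 \<in> weyl_ideal"
| plus: "p \<in> weyl_ideal \<Longrightarrow> q \<in> weyl_ideal \<Longrightarrow> p + q \<in> weyl_ideal"
| left: "p \<in> weyl_ideal \<Longrightarrow> q * p \<in> weyl_ideal"
| right: "p \<in> weyl_ideal \<Longrightarrow> p * q \<in> weyl_ideal"

lemma weyl_ideal_uminus: "p \<in> weyl_ideal \<Longrightarrow> - p \<in> weyl_ideal"
  using weyl_ideal.left[of p "- 1"] by simp

lemma weyl_ideal_diff: "p \<in> weyl_ideal \<Longrightarrow> q \<in> weyl_ideal \<Longrightarrow> p - q \<in> weyl_ideal"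
  using weyl_ideal.plus[OF _ weyl_ideal_uminus, of p q] by simp

definition free_extend ::
  "('a fmon \<Rightarrow> complex \<Rightarrow> 'b :: comm_monoid_add) \<Rightarrow> ('a fmon \<Rightarrow>\<^sub>0 complex) \<Rightarrow> 'b" where
  "free_extend h p = (\<Sum>w\<in>Poly_Mapping.keys p. h w (Poly_Mapping.lookup p w))"

lemma free_extend_superset:
  assumes "\<And>w. h w 0 = 0" "finite A" "Poly_Mapping.keys p \<subseteq> A"
  shows "free_extend h p = (\<Sum>w\<in>A. h w (Poly_Mapping.lookup p w))"
  unfolding free_extend_def using assms
  by (intro sum.mono_neutral_left) (auto simp: in_keys_iff)

lemma free_extend_add:
  assumes "\<And>w. h w 0 = 0" "\<And>w c d. h w (c + d) = h w c + h w d"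
  shows "free_extend h (p + q) = free_extend h p + free_extend h q"
proof -
  let ?A = "Poly_Mapping.keys p \<union> Poly_Mapping.keys q"
  have "Poly_Mapping.keys (p + q) \<subseteq> ?A"
    by (rule Poly_Mapping.keys_add)
  then show ?thesis
    by (simp add: free_extend_superset[of h ?A] assms lookup_add sum.distrib)
qed

lemma free_extend_single:
  assumes "h w 0 = 0"
  shows "free_extend h (Poly_Mapping.single w c) = h w c"
  using assms by (simp add: free_extend_def)

lemma free_induct:
  fixes p :: "'a fmon \<Rightarrow>\<^sub>0 complex"
  assumes "\<And>w c. P (Poly_Mapping.single w c)" "\<And>p q. P p \<Longrightarrow> P q \<Longrightarrow> P (p + q)"
  shows "P p"
proof (induction p rule: update_induct)
  case const
  show ?case using assms(1)[of 0 0] by simp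
next
  case (update f a b)
  have "Poly_Mapping.update a b f = f + Poly_Mapping.single a b"
    using update(1)
    by (intro poly_mapping_eqI) (auto simp: lookup_update lookup_add lookup_single when_def in_keys_iff)
  then show ?case using assms update by simp
qed


text \<open>The Weyl algebra acts on formal power series, \<open>V\<close> by multiplication and \<open>V\<^sup>*\<close> by derivations.\<close>

definition fock_mul :: "complex ^ 'n \<Rightarrow> (('n :: finite \<Rightarrow> nat) \<Rightarrow> complex) \<Rightarrow> ('n \<Rightarrow> nat) \<Rightarrow> complex" where
  "fock_mul v a m = (\<Sum>i\<in>UNIV. v $ i * (if m i = 0 then 0 else a (m(i := m i - 1))))"

definition fock_der :: "('n :: finite) cdual \<Rightarrow> (('n \<Rightarrow> nat) \<Rightarrow> complex) \<Rightarrow> ('n \<Rightarrow> nat) \<Rightarrow> complex" where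
  "fock_der l a m = (\<Sum>i\<in>UNIV. cdual_apply l (axis i 1) * (of_nat (Suc (m i)) * a (m(i := Suc (m i)))))"

definition fock :: "('n :: finite) phase \<Rightarrow> (('n \<Rightarrow> nat) \<Rightarrow> complex) \<Rightarrow> ('n \<Rightarrow> nat) \<Rightarrow> complex" where
  "fock u a m = fock_mul (fst u) a m + fock_der (snd u) a m"

lemma fock_mul_commute: "fock_mul v (fock_mul w a) m = fock_mul w (fock_mul v a) m"
proof -
  have "fock_mul v (fock_mul w a) m = (\<Sum>i\<in>UNIV. \<Sum>j\<in>UNIV. v $ i * w $ j *
      (if m i = 0 \<or> (m(i := m i - 1)) j = 0 then 0
       else a (m(i := m i - 1, j := (m(i := m i - 1)) j - 1))))" for v w
    unfolding fock_mul_def by (intro sum.cong refl) (auto simp: sum_distrib_left intro!: sum.cong)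
  note * = this
  show ?thesis
    unfolding * by (subst sum.swap, intro sum.cong refl) (auto simp: fun_upd_twist)
qed

lemma fock_der_commute: "fock_der v (fock_der w a) m = fock_der w (fock_der v a) m"
proof -
  have "fock_der v (fock_der w a) m = (\<Sum>i\<in>UNIV. \<Sum>j\<in>UNIV. cdual_apply v (axis i 1) * cdual_apply w (axis j 1) *
      (of_nat (Suc (m i)) * of_nat (Suc ((m(i := Suc (m i))) j)) *
       a (m(i := Suc (m i), j := Suc ((m(i := Suc (m i))) j)))))" for v w
    unfolding fock_der_def by (intro sum.cong refl) (simp add: sum_distrib_left mult_ac)
  note * = this
  show ?thesis
    unfolding * by (subst sum.swap, intro sum.cong refl) (auto simp: fun_upd_twist)
qed

lemma cdual_add: "cdual_apply l (v + w) = cdual_apply l v + cdual_apply l w"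
  and cdual_scale_vec: "cdual_apply l (c *s v) = c * cdual_apply l v"
  using cdual_apply[of l] by (simp_all add: linear_complex_iff)

lemma cdual_expand: "cdual_apply l v = (\<Sum>i\<in>UNIV. v $ i * cdual_apply l (axis i 1))"
proof -
  have "cdual_apply l (\<Sum>i\<in>A. v $ i *s axis i 1) = (\<Sum>i\<in>A. v $ i * cdual_apply l (axis i 1))"
    if "finite A" for A
    using that
  proof (induction A)
    case empty
    show ?case using cdual_scale_vec[of l 0 0] by simp
  qed (simp add: cdual_add cdual_scale_vec)
  from this[of UNIV] show ?thesis
    by (simp add: basis_expansion)
qed

lemma fock_der_mul:
  fixes l :: "('n :: finite) cdual"
  shows "fock_der l (fock_mul v a) m - fock_mul v (fock_der l a) m = cdual_apply l v * a m"
proof -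
  let ?l = "\<lambda>i. cdual_apply l (axis i 1)"
  have 1: "fock_der l (fock_mul v a) m = (\<Sum>i\<in>UNIV. \<Sum>j\<in>UNIV. ?l i * v $ j *
      (of_nat (Suc (m i)) * (if (m(i := Suc (m i))) j = 0 then 0
        else a (m(i := Suc (m i), j := (m(i := Suc (m i))) j - 1)))))"
    unfolding fock_der_def fock_mul_def
    by (intro sum.cong refl) (auto simp: sum_distrib_left mult_ac intro!: sum.cong)
  have "fock_mul v (fock_der l a) m = (\<Sum>j\<in>UNIV. \<Sum>i\<in>UNIV. ?l i * v $ j *
      (if m j = 0 then 0 else of_nat (Suc ((m(j := m j - 1)) i)) *
        a (m(j := m j - 1, i := Suc ((m(j := m j - 1)) i)))))"
    unfolding fock_der_def fock_mul_def
    by (intro sum.cong refl) (auto simp: sum_distrib_left mult_ac intro!: sum.cong)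
  then have 2: "fock_mul v (fock_der l a) m = (\<Sum>i\<in>UNIV. \<Sum>j\<in>UNIV. ?l i * v $ j *
      (if m j = 0 then 0 else of_nat (Suc ((m(j := m j - 1)) i)) *
        a (m(j := m j - 1, i := Suc ((m(j := m j - 1)) i)))))"
    by (subst sum.swap)
  have "fock_der l (fock_mul v a) m - fock_mul v (fock_der l a) m =
      (\<Sum>i\<in>UNIV. \<Sum>j\<in>UNIV. if j = i then ?l i * v $ i * a m else 0)"
    unfolding 1 2 sum_subtractf[symmetric]
  proof (intro sum.cong refl)
    fix i j :: 'n
    show "?l i * v $ j * (of_nat (Suc (m i)) * (if (m(i := Suc (m i))) j = 0 then 0
        else a (m(i := Suc (m i), j := (m(i := Suc (m i))) j - 1)))) -
      ?l i * v $ j * (if m j = 0 then 0 else of_nat (Suc ((m(j := m j - 1)) i)) *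
        a (m(j := m j - 1, i := Suc ((m(j := m j - 1)) i)))) =
      (if j = i then ?l i * v $ i * a m else 0)"
    proof (cases "j = i")
      case True
      then show ?thesis
        by (cases "m i") (auto simp: algebra_simps fun_upd_idem)
    next
      case False
      then show ?thesis
        by (auto simp: fun_upd_twist)
    qed
  qed
  also have "\<dots> = cdual_apply l v * a m"
    by (simp add: cdual_expand[of l v] sum_distrib_left mult_ac)
  finally show ?thesis .
qed

lemma fock_mul_add: "fock_mul v (\<lambda>m. a m + b m) m = fock_mul v a m + fock_mul v b m"
  and fock_mul_scale: "fock_mul v (\<lambda>m. c * a m) m = c * fock_mul v a m"
  by (auto simp: fock_mul_def sum.distrib[symmetric] sum_distrib_left algebra_simps intro!: sum.cong)

lemma fock_der_add: "fock_der l (\<lambda>m. a m + b m) m = fock_der l a m + fock_der l b m"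
  and fock_der_scale: "fock_der l (\<lambda>m. c * a m) m = c * fock_der l a m"
  by (auto simp: fock_der_def sum.distrib[symmetric] sum_distrib_left algebra_simps intro!: sum.cong)

lemma fock_add: "fock u (\<lambda>m. a m + b m) = (\<lambda>m. fock u a m + fock u b m)"
  and fock_scale: "fock u (\<lambda>m. c * a m) = (\<lambda>m. c * fock u a m)"
  by (auto simp: fock_def fock_mul_add fock_der_add fock_mul_scale fock_der_scale algebra_simps)

lemma fock_commutator:
  "fock u (fock u' a) m - fock u' (fock u a) m = symplectic u u' * a m"
proof -
  have e: "fock u (fock u' a) m =
      fock_mul (fst u) (fock_mul (fst u') a) m + fock_mul (fst u) (fock_der (snd u') a) m +
      fock_der (snd u) (fock_mul (fst u') a) m + fock_der (snd u) (fock_der (snd u') a) m" for u u'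
    using fock_mul_add[of "fst u" "fock_mul (fst u') a" "fock_der (snd u') a"]
      fock_der_add[of "snd u" "fock_mul (fst u') a" "fock_der (snd u') a"]
    by (simp add: fock_def[abs_def])
  show ?thesis
    using fock_mul_commute[of "fst u" "fst u'" a m] fock_der_commute[of "snd u" "snd u'" a m]
      fock_der_mul[of "snd u" "fst u'" a m] fock_der_mul[of "snd u'" "fst u" a m]
    by (simp add: e symplectic_def algebra_simps)
qed

definition fock_word ::
  "('n :: finite) phase fmon \<Rightarrow> (('n \<Rightarrow> nat) \<Rightarrow> complex) \<Rightarrow> ('n \<Rightarrow> nat) \<Rightarrow> complex" where
  "fock_word w = foldr fock (letters w)"

lemma fock_word_add: "fock_word w (\<lambda>m. a m + b m) = (\<lambda>m. fock_word w a m + fock_word w b m)"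
proof -
  have "foldr fock xs (\<lambda>m. a m + b m) = (\<lambda>m. foldr fock xs a m + foldr fock xs b m)" for xs
    by (induction xs) (simp_all add: fock_add)
  then show ?thesis by (simp add: fock_word_def)
qed

lemma fock_word_scale: "fock_word w (\<lambda>m. c * a m) = (\<lambda>m. c * fock_word w a m)"
proof -
  have "foldr fock xs (\<lambda>m. c * a m) = (\<lambda>m. c * foldr fock xs a m)" for xs
    by (induction xs) (simp_all add: fock_scale)
  then show ?thesis by (simp add: fock_word_def)
qed

lemma fock_word_plus: "fock_word (w + w') a = fock_word w (fock_word w' a)"
  by (simp add: fock_word_def plus_fmon_def)

definition fock_eval ::
  "(('n :: finite) phase fmon \<Rightarrow>\<^sub>0 complex) \<Rightarrow> (('n \<Rightarrow> nat) \<Rightarrow> complex) \<Rightarrow> ('n \<Rightarrow> nat) \<Rightarrow> complex" where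
  "fock_eval p a m = free_extend (\<lambda>w c. c * fock_word w a m) p"

lemma fock_eval_single: "fock_eval (Poly_Mapping.single w c) a = (\<lambda>m. c * fock_word w a m)"
  by (simp add: fock_eval_def[abs_def] free_extend_single)

lemma fock_eval_plus: "fock_eval (p + q) a = (\<lambda>m. fock_eval p a m + fock_eval q a m)"
  by (simp add: fock_eval_def[abs_def] free_extend_add algebra_simps)

lemma fock_eval_diff: "fock_eval (p - q) a = (\<lambda>m. fock_eval p a m - fock_eval q a m)"
  using fock_eval_plus[of "p - q" q a] by (simp add: fun_eq_iff)

lemma fock_eval_arg_add: "fock_eval p (\<lambda>m. a m + b m) = (\<lambda>m. fock_eval p a m + fock_eval p b m)"
  by (induction p rule: free_induct)
    (simp_all add: fock_eval_single fock_eval_plus fock_word_add algebra_simps fun_eq_iff)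

lemma fock_eval_mult: "fock_eval (p * q) a = fock_eval p (fock_eval q a)"
proof (induction p rule: free_induct)
  case (1 w c)
  show ?case
  proof (induction q rule: free_induct)
    case (1 w' c')
    show ?case
      by (simp add: mult_single fock_eval_single fock_word_plus fock_word_scale mult_ac)
  next
    case (2 q q')
    then show ?case
      by (simp add: distrib_left fock_eval_plus fock_eval_arg_add)
  qed
next
  case (2 p p')
  then show ?case
    by (simp add: distrib_right fock_eval_plus)
qed

lemma fock_eval_gen: "fock_eval (free_gen u) a = fock u a"
  by (simp add: free_gen_def fock_eval_single fock_word_def)

lemma fock_eval_scalar: "fock_eval (free_scalar c) a = (\<lambda>m. c * a m)"
  by (simp add: free_scalar_def fock_eval_single fock_word_def zero_fmon_def)

lemma fock_eval_0: "fock_eval 0 a = (\<lambda>m. 0)"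
  by (simp add: fock_eval_def[abs_def] free_extend_def)

lemma fock_eval_arg_0: "fock_eval p (\<lambda>m. 0) = (\<lambda>m. 0)"
  using fock_eval_arg_add[of p "\<lambda>m. 0" "\<lambda>m. 0"] by (simp add: fun_eq_iff)

lemma fock_eval_ideal: "p \<in> weyl_ideal \<Longrightarrow> fock_eval p a = (\<lambda>m. 0)"
proof (induction arbitrary: a rule: weyl_ideal.induct)
  case (add u u')
  show ?case
    by (simp add: fock_eval_diff fock_eval_plus fock_eval_gen fock_def fock_mul_def fock_der_def
        plus_cdual.rep_eq distrib_right sum.distrib)
next
  case (scale c u)
  show ?case
    by (simp add: fock_eval_diff fock_eval_mult fock_eval_scalar fock_eval_gen fock_def fock_mul_def
        fock_der_def phase_scale_def cdual_scale.rep_eq sum_distrib_left algebra_simps)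
next
  case (comm u u')
  show ?case
    by (simp add: fock_eval_diff fock_eval_mult fock_eval_scalar fock_eval_gen fock_commutator)
qed (simp_all add: fock_eval_0 fock_eval_plus fock_eval_mult fock_eval_arg_0)

lemma one_notin_weyl_ideal: "(1 :: ('n :: finite) phase fmon \<Rightarrow>\<^sub>0 complex) \<notin> weyl_ideal"
proof
  assume "(1 :: 'n phase fmon \<Rightarrow>\<^sub>0 complex) \<in> weyl_ideal"
  from fock_eval_ideal[OF this, of "\<lambda>m. 1"] show False
    using fun_cong[OF fock_eval_scalar[of 1 "\<lambda>m :: 'n \<Rightarrow> nat. 1"], of undefined]
    by (simp add: free_scalar_def fun_eq_iff)
qed


definition weyl_rel ::
  "(('n :: finite) phase fmon \<Rightarrow>\<^sub>0 complex) \<Rightarrow> ('n phase fmon \<Rightarrow>\<^sub>0 complex) \<Rightarrow> bool" where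
  "weyl_rel p q \<longleftrightarrow> p - q \<in> weyl_ideal"

lemma weyl_rel_eq: "p = q \<Longrightarrow> weyl_rel p q"
  by (simp add: weyl_rel_def weyl_ideal.zero)

quotient_type (overloaded) 'n weyl = "('n :: finite) phase fmon \<Rightarrow>\<^sub>0 complex" / weyl_rel
proof (rule equivpI)
  show "reflp weyl_rel"
    by (simp add: reflp_def weyl_rel_eq)
  show "symp_on UNIV weyl_rel"
    using weyl_ideal_uminus by (fastforce simp: symp_on_def weyl_rel_def)
  show "transp weyl_rel"
    using weyl_ideal.plus by (fastforce simp: transp_def weyl_rel_def)
qed

instantiation weyl :: (finite) ring_1
begin

lift_definition zero_weyl :: "'a weyl" is 0 .
lift_definition one_weyl :: "'a weyl" is 1 .
lift_definition plus_weyl :: "'a weyl \<Rightarrow> 'a weyl \<Rightarrow> 'a weyl" is "(+)"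
  unfolding weyl_rel_def by (subst add_diff_add) (rule weyl_ideal.plus)
lift_definition minus_weyl :: "'a weyl \<Rightarrow> 'a weyl \<Rightarrow> 'a weyl" is "(-)"
proof -
  fix p p' q q' :: "'a phase fmon \<Rightarrow>\<^sub>0 complex"
  assume "weyl_rel p p'" "weyl_rel q q'"
  moreover have "p - q - (p' - q') = (p - p') - (q - q')"
    by (simp add: algebra_simps)
  ultimately show "weyl_rel (p - q) (p' - q')"
    unfolding weyl_rel_def by (simp only: weyl_ideal_diff)
qed
lift_definition uminus_weyl :: "'a weyl \<Rightarrow> 'a weyl" is uminus
proof -
  fix p p' :: "'a phase fmon \<Rightarrow>\<^sub>0 complex"
  assume "weyl_rel p p'"
  moreover have "- p - - p' = - (p - p')"
    by simp
  ultimately show "weyl_rel (- p) (- p')"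
    unfolding weyl_rel_def by (simp only: weyl_ideal_uminus)
qed
lift_definition times_weyl :: "'a weyl \<Rightarrow> 'a weyl \<Rightarrow> 'a weyl" is "(*)"
proof -
  fix p p' q q' :: "'a phase fmon \<Rightarrow>\<^sub>0 complex"
  assume "weyl_rel p p'" "weyl_rel q q'"
  moreover have "p * q - p' * q' = (p - p') * q + p' * (q - q')"
    by (simp add: algebra_simps)
  ultimately show "weyl_rel (p * q) (p' * q')"
    unfolding weyl_rel_def by (auto intro: weyl_ideal.intros)
qed

instance
proof
  show "(0 :: 'a weyl) \<noteq> 1"
    by transfer (use weyl_ideal_uminus[of "- 1 :: 'a phase fmon \<Rightarrow>\<^sub>0 complex"] one_notin_weyl_ideal
        in \<open>auto simp: weyl_rel_def\<close>)
qed (transfer, rule weyl_rel_eq, simp add: algebra_simps)+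

end

lift_definition weyl_scalar :: "complex \<Rightarrow> ('n :: finite) weyl" is free_scalar .

definition weyl_gen :: "('n :: finite) phase \<Rightarrow> 'n weyl" where
  "weyl_gen u = abs_weyl (free_gen u)"


definition free_act ::
  "complex ^ 'n ^ 'n \<Rightarrow> (('n :: finite) phase fmon \<Rightarrow>\<^sub>0 complex) \<Rightarrow> ('n phase fmon \<Rightarrow>\<^sub>0 complex)" where
  "free_act g = free_extend (\<lambda>w. Poly_Mapping.single (FMon (map (phase_act g) (letters w))))"

text \<open>For invertible \<open>g\<close> this does not depend on the chosen representative (\<open>weyl_act_abs\<close>) and is an
  algebra endomorphism; it is not meaningful for singular \<open>g\<close>.\<close>

definition weyl_act :: "complex ^ 'n ^ 'n \<Rightarrow> ('n :: finite) weyl \<Rightarrow> 'n weyl" where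
  "weyl_act g x = abs_weyl (free_act g (rep_weyl x))"

lemma free_act_single:
  "free_act g (Poly_Mapping.single w c) = Poly_Mapping.single (FMon (map (phase_act g) (letters w))) c"
  by (simp add: free_act_def free_extend_single)

lemma free_act_gen: "free_act g (free_gen u) = free_gen (phase_act g u)"
  by (simp add: free_gen_def free_act_single)

lemma free_act_scalar: "free_act g (free_scalar c) = free_scalar c"
  by (simp add: free_scalar_def free_act_single zero_fmon_def)

lemma free_act_add: "free_act g (p + q) = free_act g p + free_act g q"
  by (simp add: free_act_def free_extend_add single_add)

lemma free_act_diff: "free_act g (p - q) = free_act g p - free_act g q"
  using free_act_add[of g "p - q" q] by simp

lemma free_act_0: "free_act g 0 = 0"
  by (simp add: free_act_def free_extend_def)

lemma free_act_mult: "free_act g (p * q) = free_act g p * free_act g q"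
proof (induction p rule: free_induct)
  case (1 w c)
  show ?case
    by (induction q rule: free_induct)
      (simp_all add: mult_single free_act_single free_act_add distrib_left plus_fmon_def)
qed (simp add: distrib_right free_act_add)

lemma phase_act_add: "phase_act g (u + u') = phase_act g u + phase_act g u'"
  unfolding phase_act_def
  by (simp add: prod_eq_iff matrix_vector_right_distrib) (transfer; simp)

lemma phase_act_scale: "phase_act g (phase_scale c u) = phase_scale c (phase_act g u)"
  unfolding phase_act_def phase_scale_def
  by (simp add: prod_eq_iff vector_scalar_commute) (transfer; simp)

lemma symplectic_phase_act:
  assumes "invertible g"
  shows "symplectic (phase_act g u) (phase_act g u') = symplectic u u'"
proof -
  have "matrix_inv g *v (g *v v) = v" for v
    using someI_ex[OF assms[unfolded invertible_def], folded matrix_inv_def]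
    by (simp add: matrix_vector_mul_assoc)
  then show ?thesis
    by (simp add: symplectic_def phase_act_def cdual_comp.rep_eq)
qed

lemma free_act_ideal:
  assumes "invertible g" "p \<in> weyl_ideal"
  shows "free_act g p \<in> weyl_ideal"
  using assms(2)
proof induction
  case (comm u u')
  show ?case
    using weyl_ideal.comm[of "phase_act g u" "phase_act g u'"]
    by (simp add: free_act_diff free_act_mult free_act_gen free_act_scalar symplectic_phase_act assms(1))
qed (simp_all add: free_act_add free_act_diff free_act_mult free_act_gen free_act_scalar free_act_0
    phase_act_add phase_act_scale weyl_ideal.intros)

lemma weyl_act_abs:
  assumes "invertible g"
  shows "weyl_act g (abs_weyl p) = abs_weyl (free_act g p)"
proof -
  have "weyl_rel (rep_weyl (abs_weyl p)) p"
    by (rule Quotient3_rep_abs[OF Quotient3_weyl]) (simp add: weyl_rel_def weyl_ideal.zero)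
  then have "weyl_rel (free_act g (rep_weyl (abs_weyl p))) (free_act g p)"
    using free_act_ideal[OF assms] by (simp add: weyl_rel_def free_act_diff[symmetric])
  then show ?thesis
    by (simp add: weyl_act_def weyl.abs_eq_iff)
qed

lemma
  fixes g :: "complex ^ 'n ^ 'n" and x y :: "('n :: finite) weyl"
  assumes "invertible g"
  shows weyl_act_gen: "weyl_act g (weyl_gen u) = weyl_gen (phase_act g u)"
    and weyl_act_scalar: "weyl_act g (weyl_scalar c) = weyl_scalar c"
    and weyl_act_add: "weyl_act g (x + y) = weyl_act g x + weyl_act g y"
    and weyl_act_mult: "weyl_act g (x * y) = weyl_act g x * weyl_act g y"
proof -
  show "weyl_act g (weyl_gen u) = weyl_gen (phase_act g u)"
    by (simp add: weyl_gen_def weyl_act_abs assms free_act_gen)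
  show "weyl_act g (weyl_scalar c) = weyl_scalar c"
    by (simp add: weyl_scalar.abs_eq weyl_act_abs assms free_act_scalar)
  show "weyl_act g (x + y) = weyl_act g x + weyl_act g y"
    by (induct x rule: weyl.abs_induct, induct y rule: weyl.abs_induct)
      (simp add: plus_weyl.abs_eq weyl_act_abs assms free_act_add)
  show "weyl_act g (x * y) = weyl_act g x * weyl_act g y"
    by (induct x rule: weyl.abs_induct, induct y rule: weyl.abs_induct)
      (simp add: times_weyl.abs_eq weyl_act_abs assms free_act_mult)
qed


section \<open>The element \<open>\<nu>'(\<Omega>'\<^sub>W)\<close>\<close>

text \<open>\<open>\<Sum>\<^sub>i f(v\<^sub>i) v\<^sub>i\<^sup>*\<close> does not depend on the basis; the standard basis and its coordinate functions
  are used.\<close>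

definition nu' :: "(complex ^ 'n \<Rightarrow> complex ^ 'n) \<Rightarrow> ('n :: finite) weyl" where
  "nu' f = (\<Sum>i\<in>UNIV. weyl_gen (f (axis i 1), 0) * weyl_gen (0, coord i))"

text \<open>\<open>\<Omega>'\<^sub>W\<close> lives in the enveloping algebra of \<open>\<ss>\<oo>(V,B)\<close>, to which \<open>\<nu>'\<close> extends
  multiplicatively.  Division by zero being zero in HOL, pairs with \<open>B(\<alpha>\<^sup>\<or>,\<beta>\<^sup>\<or>) = 0\<close> contribute \<open>0\<close>.\<close>

definition nu'_Omega' ::
  "(real ^ 'n \<Rightarrow> real ^ 'n \<Rightarrow> real) \<Rightarrow> ((real ^ 'n \<Rightarrow> real) \<Rightarrow> real ^ 'n) \<Rightarrow>
   (real ^ 'n \<Rightarrow> real) set \<Rightarrow> ((real ^ 'n \<Rightarrow> real) \<Rightarrow> complex) \<Rightarrow> ('n :: finite) weyl" where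
  "nu'_Omega' B coroot P k =
     weyl_scalar (1 / 16) *
     (\<Sum>\<alpha>\<in>P. \<Sum>\<beta>\<in>P.
        weyl_scalar (k \<alpha> * k \<beta> * (1 / complex_of_real (B (coroot \<alpha>) (coroot \<beta>)))) *
        (nu' (commutator (reflection_ext coroot \<alpha>) (reflection_ext coroot \<beta>)))\<^sup>2)"

end

theory Submission
  imports Defs
begin

text \<open>
  With \<open>a = \<alpha>\<^sup>\<or>\<close>, \<open>b = \<beta>\<^sup>\<or>\<close>, the commutator of \<open>s\<^sub>\<alpha>\<close> and \<open>s\<^sub>\<beta>\<close> is a multiple of \<open>a \<and> b\<close>, regarded as
  an element of \<open>\<ss>\<oo>(V,B)\<close>, so that \<open>\<Omega>'\<^sub>W\<close> is the sum over \<open>\<alpha>, \<beta> > 0\<close> of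
  \<open>k\<^sub>\<alpha> k\<^sub>\<beta> B(a,b) / (B(a,a)\<^sup>2 B(b,b)\<^sup>2) (a \<and> b)\<^sup>2\<close>.  Although the summand is odd in \<open>\<alpha>\<close> and in \<open>\<beta>\<close>, the
  sum does not depend on the positive system: the \<open>(\<alpha>, s\<^sub>\<alpha>\<beta>)\<close> summand is the negative of the \<open>(\<alpha>,\<beta>)\<close>
  summand, so the jump on crossing the wall of \<open>\<alpha>\<close> cancels in pairs.  Hence the form \<open>R\<close> on \<open>\<Lambda>\<^sup>2V\<close> given by the sum is \<open>W\<close>-invariant.  Every
  \<open>W\<close>-equivariant endomorphism of \<open>\<Lambda>\<^sup>2V\<close> has all \<open>a \<and> b\<close> as eigenvectors, and irreducibility of
  \<open>\<Phi>\<close> forces the eigenvalues to agree.  So \<open>R\<close> is a multiple of the form induced by \<open>B\<close>, which is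
  \<open>O(V,B)\<close>-invariant.
\<close>

section \<open>Independence of the positive system\<close>

text \<open>The sum over positive pairs is a quarter of the sign-weighted sum \<open>E\<close> over
  all pairs. Passing from \<open>x\<close> to \<open>y\<close> flips the signs on the set
  \<open>S\<close> of separating roots, so only the blocks with exactly one index in
  \<open>S\<close> change. These vanish by adding up the identities \<open>wall\<close>, taken where
  the segment meets each wall; walls met at the same point are covered because
  \<open>sgn 0 = 0\<close>.\<close>

lemma sum_sum_positive_eq:
  fixes f :: "('v::real_vector \<Rightarrow> real) \<Rightarrow> ('v \<Rightarrow> real) \<Rightarrow> complex"
  assumes fin: "finite \<Phi>"
    and lin: "\<And>\<alpha>. \<alpha> \<in> \<Phi> \<Longrightarrow> linear \<alpha>"
    and neg: "\<And>\<alpha>. \<alpha> \<in> \<Phi> \<Longrightarrow> (\<lambda>v. - \<alpha> v) \<in> \<Phi>"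
    and refl: "\<And>\<alpha> \<beta>. \<alpha> \<in> \<Phi> \<Longrightarrow> \<beta> \<in> \<Phi> \<Longrightarrow> \<beta> \<circ> s \<alpha> \<in> \<Phi>"
    and invol: "\<And>\<alpha> v. \<alpha> \<in> \<Phi> \<Longrightarrow> s \<alpha> (s \<alpha> v) = v"
    and fixed: "\<And>\<alpha> v. \<alpha> \<in> \<Phi> \<Longrightarrow> \<alpha> v = 0 \<Longrightarrow> s \<alpha> v = v"
    and sym: "\<And>\<alpha> \<beta>. f \<alpha> \<beta> = f \<beta> \<alpha>"
    and odd: "\<And>\<alpha> \<beta>. \<alpha> \<in> \<Phi> \<Longrightarrow> \<beta> \<in> \<Phi> \<Longrightarrow> f (\<lambda>v. - \<alpha> v) \<beta> = - f \<alpha> \<beta>"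
    and anti: "\<And>\<alpha> \<beta>. \<alpha> \<in> \<Phi> \<Longrightarrow> \<beta> \<in> \<Phi> \<Longrightarrow> f \<alpha> (\<beta> \<circ> s \<alpha>) = - f \<alpha> \<beta>"
    and x: "\<And>\<alpha>. \<alpha> \<in> \<Phi> \<Longrightarrow> \<alpha> x \<noteq> 0" and y: "\<And>\<alpha>. \<alpha> \<in> \<Phi> \<Longrightarrow> \<alpha> y \<noteq> 0"
  shows "(\<Sum>\<alpha>\<in>{\<alpha>\<in>\<Phi>. \<alpha> x > 0}. \<Sum>\<beta>\<in>{\<beta>\<in>\<Phi>. \<beta> x > 0}. f \<alpha> \<beta>) =
         (\<Sum>\<alpha>\<in>{\<alpha>\<in>\<Phi>. \<alpha> y > 0}. \<Sum>\<beta>\<in>{\<beta>\<in>\<Phi>. \<beta> y > 0}. f \<alpha> \<beta>)"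
proof -
  define \<epsilon> where "\<epsilon> z \<alpha> = complex_of_real (sgn (\<alpha> z))" for z :: 'v and \<alpha> :: "'v \<Rightarrow> real"
  define E where "E z = (\<Sum>\<alpha>\<in>\<Phi>. \<Sum>\<beta>\<in>\<Phi>. \<epsilon> z \<alpha> * \<epsilon> z \<beta> * f \<alpha> \<beta>)" for z
  \<comment> \<open>As \<open>h\<close> and the sign are both odd, a negative root contributes the
    same as its opposite.\<close>
  have half: "(\<Sum>\<alpha>\<in>\<Phi>. \<epsilon> z \<alpha> * h \<alpha>) = 2 * (\<Sum>\<alpha>\<in>{\<alpha>\<in>\<Phi>. \<alpha> z > 0}. h \<alpha>)"
    if h: "\<And>\<alpha>. \<alpha> \<in> \<Phi> \<Longrightarrow> h (\<lambda>v. - \<alpha> v) = - h \<alpha>" and z: "\<And>\<alpha>. \<alpha> \<in> \<Phi> \<Longrightarrow> \<alpha> z \<noteq> 0"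
    for z and h :: "('v \<Rightarrow> real) \<Rightarrow> complex"
  proof -
    let ?P = "{\<alpha>\<in>\<Phi>. \<alpha> z > 0}" and ?N = "{\<alpha>\<in>\<Phi>. \<alpha> z < 0}"
    have "\<Phi> = ?P \<union> ?N" using z by force
    then have "(\<Sum>\<alpha>\<in>\<Phi>. \<epsilon> z \<alpha> * h \<alpha>) = (\<Sum>\<alpha>\<in>?P \<union> ?N. \<epsilon> z \<alpha> * h \<alpha>)" by simp
    also have "\<dots> = (\<Sum>\<alpha>\<in>?P. \<epsilon> z \<alpha> * h \<alpha>) + (\<Sum>\<alpha>\<in>?N. \<epsilon> z \<alpha> * h \<alpha>)"
      by (rule sum.union_disjoint) (use fin in auto)
    also have "(\<Sum>\<alpha>\<in>?N. \<epsilon> z \<alpha> * h \<alpha>) = (\<Sum>\<alpha>\<in>?P. h \<alpha>)"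
      by (rule sum.reindex_bij_witness[of _ "\<lambda>\<alpha> v. - \<alpha> v" "\<lambda>\<alpha> v. - \<alpha> v"])
        (auto simp: neg h \<epsilon>_def)
    also have "(\<Sum>\<alpha>\<in>?P. \<epsilon> z \<alpha> * h \<alpha>) = (\<Sum>\<alpha>\<in>?P. h \<alpha>)"
      by (rule sum.cong) (auto simp: \<epsilon>_def)
    finally show ?thesis by simp
  qed
  have quarter: "E z = 4 * (\<Sum>\<alpha>\<in>{\<alpha>\<in>\<Phi>. \<alpha> z > 0}. \<Sum>\<beta>\<in>{\<beta>\<in>\<Phi>. \<beta> z > 0}. f \<alpha> \<beta>)"
    if z: "\<And>\<alpha>. \<alpha> \<in> \<Phi> \<Longrightarrow> \<alpha> z \<noteq> 0" for z
  proof -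
    have "E z = (\<Sum>\<alpha>\<in>\<Phi>. \<epsilon> z \<alpha> * (\<Sum>\<beta>\<in>\<Phi>. \<epsilon> z \<beta> * f \<alpha> \<beta>))"
      by (simp add: E_def sum_distrib_left mult.assoc)
    also have "\<dots> = 2 * (\<Sum>\<alpha>\<in>{\<alpha>\<in>\<Phi>. \<alpha> z > 0}. \<Sum>\<beta>\<in>\<Phi>. \<epsilon> z \<beta> * f \<alpha> \<beta>)"
      by (rule half) (auto simp: odd sum_negf z)
    also have "(\<Sum>\<alpha>\<in>{\<alpha>\<in>\<Phi>. \<alpha> z > 0}. \<Sum>\<beta>\<in>\<Phi>. \<epsilon> z \<beta> * f \<alpha> \<beta>) =
        (\<Sum>\<alpha>\<in>{\<alpha>\<in>\<Phi>. \<alpha> z > 0}. 2 * (\<Sum>\<beta>\<in>{\<beta>\<in>\<Phi>. \<beta> z > 0}. f \<alpha> \<beta>))"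
      by (intro sum.cong refl half) (auto simp: z sym[of _ "\<lambda>v. - _ v"] odd intro: sym)
    finally show ?thesis by (simp add: sum_distrib_left)
  qed
  \<comment> \<open>Reflection in \<alpha> fixes \<open>z\<close>, so it permutes the roots without
    changing their signs at \<open>z\<close>, while \<open>f \<alpha>\<close> changes sign: the sum
    equals its own negative.\<close>
  have wall: "(\<Sum>\<beta>\<in>\<Phi>. \<epsilon> z \<beta> * f \<alpha> \<beta>) = 0" if a: "\<alpha> \<in> \<Phi>" "\<alpha> z = 0" for \<alpha> z
  proof -
    have "(\<Sum>\<beta>\<in>\<Phi>. \<epsilon> z \<beta> * f \<alpha> \<beta>) = (\<Sum>\<beta>\<in>\<Phi>. - (\<epsilon> z \<beta> * f \<alpha> \<beta>))"
      by (rule sum.reindex_bij_witness[of _ "\<lambda>\<beta>. \<beta> \<circ> s \<alpha>" "\<lambda>\<beta>. \<beta> \<circ> s \<alpha>"])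
        (use a in \<open>auto simp: refl invol fixed anti \<epsilon>_def fun_eq_iff\<close>)
    then show ?thesis by (simp add: sum_negf)
  qed
  \<comment> \<open>\<open>S\<close> holds the roots whose wall separates \<open>x\<close> from
    \<open>y\<close>; \<open>t \<alpha>\<close> is the parameter at which the segment meets that
    wall.\<close>
  define S where "S = {\<alpha>\<in>\<Phi>. \<alpha> x * \<alpha> y < 0}"
  define t where "t \<alpha> = \<alpha> x / (\<alpha> x - \<alpha> y)" for \<alpha> :: "'v \<Rightarrow> real"
  \<comment> \<open>the point of the segment from \<open>x\<close> to \<open>y\<close> on the wall of \<open>\<alpha>\<close>, which is fixed by \<open>s \<alpha>\<close>\<close>
  define z where "z \<alpha> = x + t \<alpha> *\<^sub>R (y - x)" for \<alpha>
  have S: "S \<subseteq> \<Phi>" "finite S" using fin by (auto simp: S_def)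
  have z_eval: "\<beta> (z \<alpha>) = \<beta> x + t \<alpha> * (\<beta> y - \<beta> x)" if "\<beta> \<in> \<Phi>" for \<alpha> \<beta>
    using lin[OF that] by (simp add: z_def linear_add linear_diff linear_scale)
  have tS: "0 < t \<alpha> \<and> t \<alpha> < 1 \<and> \<alpha> x \<noteq> \<alpha> y" if "\<alpha> \<in> S" for \<alpha>
    using that by (auto simp: S_def t_def divide_simps mult_less_0_iff)
  have z0: "\<alpha> (z \<alpha>) = 0" if "\<alpha> \<in> S" for \<alpha>
  proof -
    have "\<alpha> \<in> \<Phi>" using that S by auto
    then show ?thesis using tS[OF that] by (simp add: z_eval) (simp add: t_def field_simps)
  qed
  have \<epsilon>_flip: "\<epsilon> y \<alpha> = (if \<alpha> \<in> S then - \<epsilon> x \<alpha> else \<epsilon> x \<alpha>)" if "\<alpha> \<in> \<Phi>" for \<alpha>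
    using that x[OF that] y[OF that] by (auto simp: S_def \<epsilon>_def sgn_if mult_less_0_iff)
  \<comment> \<open>A root outside \<open>S\<close> has the same sign at both ends of the segment,
    hence at every point between them.\<close>
  have \<epsilon>_out: "\<epsilon> (z \<alpha>) \<beta> = \<epsilon> x \<beta>" if "\<alpha> \<in> S" "\<beta> \<in> \<Phi>" "\<beta> \<notin> S" for \<alpha> \<beta>
  proof -
    have "\<beta> (z \<alpha>) = (1 - t \<alpha>) * \<beta> x + t \<alpha> * \<beta> y" using that by (simp add: z_eval algebra_simps)
    moreover have "\<beta> x > 0 \<and> \<beta> y > 0 \<or> \<beta> x < 0 \<and> \<beta> y < 0"
      using that x[of \<beta>] y[of \<beta>] by (auto simp: S_def mult_less_0_iff not_less linorder_neq_iff)
    ultimately show ?thesis using tS[OF that(1)]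
      by (auto simp: \<epsilon>_def add_pos_pos add_neg_neg mult_pos_neg)
  qed
  \<comment> \<open>Along the segment \<beta> is affine and vanishes at parameter
    \<open>t \<beta>\<close>, so it still has its sign from \<open>x\<close> before that parameter
    and the opposite one after it.\<close>
  have \<epsilon>_in: "\<epsilon> (z \<alpha>) \<beta> = \<epsilon> x \<beta> * of_real (sgn (t \<beta> - t \<alpha>))" if "\<alpha> \<in> S" "\<beta> \<in> S" for \<alpha> \<beta>
  proof -
    have "(\<beta> x - \<beta> y) * t \<beta> = \<beta> x"
      using tS[OF that(2)] by (simp add: t_def)
    then have "\<beta> (z \<alpha>) = (\<beta> x - \<beta> y) * (t \<beta> - t \<alpha>)"
      using that S by (simp add: z_eval subset_iff algebra_simps)
    moreover have "sgn (\<beta> x - \<beta> y) = sgn (\<beta> x)"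
      using that(2) by (auto simp: S_def sgn_if mult_less_0_iff)
    ultimately show ?thesis by (simp add: \<epsilon>_def sgn_mult)
  qed
  let ?A = "\<Sum>\<alpha>\<in>S. \<Sum>\<beta>\<in>\<Phi> - S. \<epsilon> x \<alpha> * \<epsilon> x \<beta> * f \<alpha> \<beta>"
  let ?B = "\<Sum>\<alpha>\<in>S. \<Sum>\<beta>\<in>S. \<epsilon> x \<alpha> * \<epsilon> x \<beta> * of_real (sgn (t \<beta> - t \<alpha>)) * f \<alpha> \<beta>"
  have split: "(\<Sum>\<beta>\<in>\<Phi>. h \<beta>) = (\<Sum>\<beta>\<in>\<Phi> - S. h \<beta>) + (\<Sum>\<beta>\<in>S. h \<beta>)" for h :: "_ \<Rightarrow> complex"
    using sum.subset_diff[OF S(1) fin] .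
  \<comment> \<open>Every inner sum is an instance of \<open>wall\<close>; splitting it at
    \<open>S\<close> leaves the mixed block \<open>?A\<close> and a correction \<open>?B\<close>
    inside \<open>S\<close>.\<close>
  have "0 = (\<Sum>\<alpha>\<in>S. \<epsilon> x \<alpha> * (\<Sum>\<beta>\<in>\<Phi>. \<epsilon> (z \<alpha>) \<beta> * f \<alpha> \<beta>))"
    using S z0 by (simp add: wall subset_iff)
  also have "\<dots> = ?A + ?B"
    unfolding split
    by (simp add: distrib_left sum.distrib sum_distrib_left \<epsilon>_out \<epsilon>_in mult_ac cong: sum.cong_simp)
  finally have AB: "?A + ?B = 0" by simp
  \<comment> \<open>\<open>f\<close> is symmetric and the sign of
    \<open>t \<beta> - t \<alpha>\<close> is antisymmetric, so swapping the indices negates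
    \<open>?B\<close>.\<close>
  have "?B = (\<Sum>\<alpha>\<in>S. \<Sum>\<beta>\<in>S. \<epsilon> x \<beta> * \<epsilon> x \<alpha> * of_real (sgn (t \<alpha> - t \<beta>)) * f \<beta> \<alpha>)"
    by (rule sum.swap)
  also have "\<dots> = (\<Sum>\<alpha>\<in>S. \<Sum>\<beta>\<in>S. - (\<epsilon> x \<alpha> * \<epsilon> x \<beta> * of_real (sgn (t \<beta> - t \<alpha>)) * f \<alpha> \<beta>))"
  proof (intro sum.cong HOL.refl)
    fix \<alpha> \<beta>
    have "sgn (t \<alpha> - t \<beta>) = - sgn (t \<beta> - t \<alpha>)" by (simp add: sgn_if)
    then show "\<epsilon> x \<beta> * \<epsilon> x \<alpha> * of_real (sgn (t \<alpha> - t \<beta>)) * f \<beta> \<alpha> =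
        - (\<epsilon> x \<alpha> * \<epsilon> x \<beta> * of_real (sgn (t \<beta> - t \<alpha>)) * f \<alpha> \<beta>)"
      by (simp add: sym[of \<beta> \<alpha>])
  qed
  finally have "?B = 0" by (simp add: sum_negf)
  then have A: "?A = 0" using AB by simp
  have A': "(\<Sum>\<alpha>\<in>\<Phi> - S. \<Sum>\<beta>\<in>S. \<epsilon> x \<alpha> * \<epsilon> x \<beta> * f \<alpha> \<beta>) = 0"
    using A by (subst sum.swap) (simp add: mult_ac sym)
  have Ex: "E w = (\<Sum>\<alpha>\<in>\<Phi> - S. \<Sum>\<beta>\<in>\<Phi> - S. \<epsilon> w \<alpha> * \<epsilon> w \<beta> * f \<alpha> \<beta>)
     + (\<Sum>\<alpha>\<in>\<Phi> - S. \<Sum>\<beta>\<in>S. \<epsilon> w \<alpha> * \<epsilon> w \<beta> * f \<alpha> \<beta>)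
     + ((\<Sum>\<alpha>\<in>S. \<Sum>\<beta>\<in>\<Phi> - S. \<epsilon> w \<alpha> * \<epsilon> w \<beta> * f \<alpha> \<beta>)
     + (\<Sum>\<alpha>\<in>S. \<Sum>\<beta>\<in>S. \<epsilon> w \<alpha> * \<epsilon> w \<beta> * f \<alpha> \<beta>))" for w
    unfolding E_def split by (simp add: sum.distrib)
  have flip: "\<epsilon> y \<alpha> = - \<epsilon> x \<alpha>" if "\<alpha> \<in> S" for \<alpha> using \<epsilon>_flip[of \<alpha>] that S by auto
  have keep: "\<epsilon> y \<alpha> = \<epsilon> x \<alpha>" if "\<alpha> \<in> \<Phi>" "\<alpha> \<notin> S" for \<alpha> using \<epsilon>_flip[of \<alpha>] that by auto
  \<comment> \<open>Two flips cancel on the block inside \<open>S\<close>, and the mixed blocks are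
    zero at both ends.\<close>
  have "E y = E x"
    unfolding Ex[of x] Ex[of y] using A A' by (simp add: flip keep sum_negf cong: sum.cong_simp)
  then show ?thesis by (simp add: quarter x y)
qed

section \<open>Complexified root geometry\<close>

lemma Re_vec_simps [simp]:
  "Re_vec (v + w) = Re_vec v + Re_vec w" "Re_vec (v - w) = Re_vec v - Re_vec w"
  "Re_vec (c *s v) = Re c *\<^sub>R Re_vec v - Im c *\<^sub>R Im_vec v" "Re_vec (of_real_vec x) = x" "Re_vec (- v) = - Re_vec v"
  by (simp_all add: Re_vec_def Im_vec_def of_real_vec_def vec_eq_iff)

lemma Im_vec_simps [simp]:
  "Im_vec (v + w) = Im_vec v + Im_vec w" "Im_vec (v - w) = Im_vec v - Im_vec w"
  "Im_vec (c *s v) = Re c *\<^sub>R Im_vec v + Im c *\<^sub>R Re_vec v" "Im_vec (of_real_vec x) = 0" "Im_vec (- v) = - Im_vec v"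
  by (simp_all add: Re_vec_def Im_vec_def of_real_vec_def vec_eq_iff)

lemma of_real_vec_simps:
  "of_real_vec (v + w) = of_real_vec v + of_real_vec w"
  "of_real_vec (v - w) = of_real_vec v - of_real_vec w"
  "of_real_vec (r *\<^sub>R v) = of_real r *s of_real_vec v"
  "of_real_vec 0 = 0"
  by (simp_all add: of_real_vec_def vec_eq_iff)

lemma complex_vec_decompose: "v = of_real_vec (Re_vec v) + \<i> *s of_real_vec (Im_vec v)"
  by (simp add: vec_eq_iff of_real_vec_def Re_vec_def Im_vec_def complex_eq_iff)

locale irreducible_root_system =
  fixes \<Phi> :: "(real ^ 'n \<Rightarrow> real) set"
    and coroot :: "(real ^ 'n \<Rightarrow> real) \<Rightarrow> real ^ 'n"
    and B :: "real ^ 'n \<Rightarrow> real ^ 'n \<Rightarrow> real"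
    and k :: "(real ^ 'n \<Rightarrow> real) \<Rightarrow> complex"
  assumes root_system: "root_system \<Phi> coroot"
    and irreducible: "irreducible_roots \<Phi> coroot"
    and form: "invariant_form \<Phi> coroot B"
    and parameter: "invariant_parameter \<Phi> coroot k"
begin

section \<open>Real coroots, reflections and the form \<open>B\<close>\<close>

abbreviation refl :: "(real ^ 'n \<Rightarrow> real) \<Rightarrow> real ^ 'n \<Rightarrow> real ^ 'n" where
  "refl \<equiv> reflection coroot"

lemma finite_roots: "finite \<Phi>"
  and linear_root: "\<alpha> \<in> \<Phi> \<Longrightarrow> linear \<alpha>"
  and root_coroot: "\<alpha> \<in> \<Phi> \<Longrightarrow> \<alpha> (coroot \<alpha>) = 2"
  and root_refl: "\<alpha> \<in> \<Phi> \<Longrightarrow> \<beta> \<in> \<Phi> \<Longrightarrow> \<beta> \<circ> refl \<alpha> \<in> \<Phi>"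
  using root_system by (auto simp: root_system_def)

lemma bilinear_B: "bilinear B" and B_commute: "B v w = B w v"
  and B_pos: "v \<noteq> 0 \<Longrightarrow> B v v > 0"
  using form by (auto simp: invariant_form_def)

lemmas B_simps [simp] =
  bilinear_ladd[OF bilinear_B] bilinear_radd[OF bilinear_B]
  bilinear_lsub[OF bilinear_B] bilinear_rsub[OF bilinear_B]
  bilinear_lmul[OF bilinear_B] bilinear_rmul[OF bilinear_B]
  bilinear_lzero[OF bilinear_B] bilinear_rzero[OF bilinear_B]

lemma root_simps [simp]:
  assumes "\<alpha> \<in> \<Phi>"
  shows "\<alpha> (v + w) = \<alpha> v + \<alpha> w" "\<alpha> (v - w) = \<alpha> v - \<alpha> w" "\<alpha> (r *\<^sub>R v) = r * \<alpha> v" "\<alpha> 0 = 0"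
    "\<alpha> (- v) = - \<alpha> v"
  using linear_root[OF assms]
  by (simp_all add: linear_add linear_diff linear_scale linear_0 linear_neg)

lemma refl_coroot: "\<alpha> \<in> \<Phi> \<Longrightarrow> refl \<alpha> (coroot \<alpha>) = - coroot \<alpha>"
  by (simp add: reflection_def root_coroot scaleR_2)

lemma refl_refl [simp]: "\<alpha> \<in> \<Phi> \<Longrightarrow> refl \<alpha> (refl \<alpha> v) = v"
  by (simp add: reflection_def root_coroot)

lemma refl_in_weyl: "\<alpha> \<in> \<Phi> \<Longrightarrow> refl \<alpha> \<in> weyl_group \<Phi> coroot"
  using weyl_group.step[OF _ weyl_group.id, of \<alpha> \<Phi> coroot] by simp

lemma B_refl: "\<alpha> \<in> \<Phi> \<Longrightarrow> B (refl \<alpha> v) (refl \<alpha> w) = B v w"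
  using form refl_in_weyl[of \<alpha>] by (simp add: invariant_form_def)

lemma k_refl: "\<alpha> \<in> \<Phi> \<Longrightarrow> \<beta> \<in> \<Phi> \<Longrightarrow> k (\<beta> \<circ> refl \<alpha>) = k \<beta>"
proof -
  assume a: "\<alpha> \<in> \<Phi>" and b: "\<beta> \<in> \<Phi>"
  have "inv (refl \<alpha>) = refl \<alpha>"
    by (rule inv_unique_comp) (auto simp: fun_eq_iff a)
  then show "k (\<beta> \<circ> refl \<alpha>) = k \<beta>"
    using parameter refl_in_weyl[OF a] b by (auto simp: invariant_parameter_def dest: bspec)
qed

lemma coroot_nz: "\<alpha> \<in> \<Phi> \<Longrightarrow> coroot \<alpha> \<noteq> 0"
  using root_coroot[of \<alpha>] by force

lemma B_coroot_pos: "\<alpha> \<in> \<Phi> \<Longrightarrow> B (coroot \<alpha>) (coroot \<alpha>) > 0"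
  by (simp add: B_pos coroot_nz)

text \<open>The reflection preserves \<open>B\<close> and negates the coroot, so \<open>B (refl
  \<alpha> v) (coroot \<alpha>) = - B v (coroot \<alpha>)\<close>; expanding the reflection gives
  the claim.\<close>

lemma root_eq_B: "\<alpha> \<in> \<Phi> \<Longrightarrow> \<alpha> v * B (coroot \<alpha>) (coroot \<alpha>) = 2 * B (coroot \<alpha>) v"
proof -
  assume a: "\<alpha> \<in> \<Phi>"
  have "B (refl \<alpha> v) (coroot \<alpha>) = - B v (coroot \<alpha>)"
    using B_refl[OF a, of v "coroot \<alpha>"]
    by (simp add: a refl_coroot bilinear_rneg[OF bilinear_B])
  then show ?thesis
    using B_commute[of v] by (simp add: reflection_def)
qed

text \<open>Evaluating both descriptions of \<alpha> at \<open>c\<close> and at the coroot shows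
  that the difference of the two vectors has norm zero.\<close>

lemma coroot_unique:
  assumes "\<alpha> \<in> \<Phi>" "c \<noteq> 0" "\<And>v. \<alpha> v * B c c = 2 * B c v"
  shows "coroot \<alpha> = c"
proof -
  let ?a = "coroot \<alpha>"
  have 1: "B c c = B c ?a" using assms(3)[of ?a] root_coroot[OF assms(1)] by simp
  have "\<alpha> c = 2" using assms(3)[of c] B_pos[OF assms(2)] by simp
  then have 2: "B ?a ?a = B ?a c" using root_eq_B[OF assms(1), of c] by simp
  have "B (?a - c) (?a - c) = 0" using 1 2 by (simp add: B_commute[of c ?a])
  then show ?thesis using B_pos[of "?a - c"] by fastforce
qed

text \<open>The axioms only say that a reflected coroot is again some coroot. Which one it is
  follows from \<open>coroot_unique\<close>, by transporting \<open>root_eq_B\<close> along the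
  isometry \<open>refl \<alpha>\<close>.\<close>

lemma coroot_refl:
  assumes "\<alpha> \<in> \<Phi>" "\<beta> \<in> \<Phi>"
  shows "coroot (\<beta> \<circ> refl \<alpha>) = refl \<alpha> (coroot \<beta>)"
proof (rule coroot_unique)
  show "\<beta> \<circ> refl \<alpha> \<in> \<Phi>" by (rule root_refl[OF assms])
  show "refl \<alpha> (coroot \<beta>) \<noteq> 0"
    using B_refl[OF assms(1), of "coroot \<beta>" "coroot \<beta>"] B_coroot_pos[OF assms(2)] by auto
  show "(\<beta> \<circ> refl \<alpha>) v * B (refl \<alpha> (coroot \<beta>)) (refl \<alpha> (coroot \<beta>)) = 2 * B (refl \<alpha> (coroot \<beta>)) v" for v
    using root_eq_B[OF assms(2), of "refl \<alpha> v"] B_refl[OF assms(1), of "coroot \<beta>" "refl \<alpha> v"]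
    by (simp add: assms B_refl)
qed

text \<open>Exhibits the opposite of a root as a reflected root, so that closure under negation
  follows from closure under reflections.\<close>

lemma minus_root: "\<alpha> \<in> \<Phi> \<Longrightarrow> (\<lambda>v. - \<alpha> v) = \<alpha> \<circ> refl \<alpha>"
  by (simp add: fun_eq_iff reflection_def root_coroot)

text \<open>The roots span the dual space, and each root is represented by a positive multiple of
  its coroot.\<close>

lemma exists_representer:
  assumes "linear f"
  shows "\<exists>z\<in>span (coroot ` \<Phi>). \<forall>v. f v = B z v"
proof -
  from assms root_system obtain c where c: "f = (\<lambda>v. \<Sum>\<alpha>\<in>\<Phi>. c \<alpha> * \<alpha> v)"
    unfolding root_system_def by blast
  define z where "z = (\<Sum>\<alpha>\<in>\<Phi>. (c \<alpha> * 2 / B (coroot \<alpha>) (coroot \<alpha>)) *\<^sub>R coroot \<alpha>)"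
  have "f v = B z v" for v
  proof -
    interpret linear "\<lambda>z. B z v" using bilinear_B by (simp add: bilinear_def)
    have "B z v = (\<Sum>\<alpha>\<in>\<Phi>. (c \<alpha> * 2 / B (coroot \<alpha>) (coroot \<alpha>)) * B (coroot \<alpha>) v)"
      by (simp add: z_def sum)
    also have "\<dots> = f v"
      unfolding c
    proof (rule sum.cong)
      fix \<alpha> assume a: "\<alpha> \<in> \<Phi>"
      show "(c \<alpha> * 2 / B (coroot \<alpha>) (coroot \<alpha>)) * B (coroot \<alpha>) v = c \<alpha> * \<alpha> v"
        using root_eq_B[OF a, of v] B_coroot_pos[OF a] by (simp add: field_simps)
    qed simp
    finally show ?thesis by simp
  qed
  moreover have "z \<in> span (coroot ` \<Phi>)"
    unfolding z_def by (intro span_sum span_scale span_base) auto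
  ultimately show ?thesis by blast
qed

text \<open>A representer of \<open>B w\<close> inside the span must equal \<open>w\<close>, since
  \<open>B\<close> is definite.\<close>

lemma span_coroots: "span (coroot ` \<Phi>) = UNIV"
proof -
  have "w \<in> span (coroot ` \<Phi>)" for w
  proof -
    have "linear (B w)" using bilinear_B by (simp add: bilinear_def)
    from exists_representer[OF this] obtain z
      where z: "z \<in> span (coroot ` \<Phi>)" "\<And>v. B w v = B z v" by blast
    have "B (w - z) (w - z) = 0" using z(2)[of "w - z"] by simp
    then have "w = z" using B_pos[of "w - z"] by fastforce
    then show ?thesis using z by simp
  qed
  then show ?thesis by blast
qed

section \<open>The complex form and the complexified coroots\<close>

definition C :: "complex ^ 'n \<Rightarrow> complex ^ 'n \<Rightarrow> complex" where "C = form_ext B"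

definition cv :: "(real ^ 'n \<Rightarrow> real) \<Rightarrow> complex ^ 'n" where "cv \<alpha> = of_real_vec (coroot \<alpha>)"

abbreviation sc :: "(real ^ 'n \<Rightarrow> real) \<Rightarrow> complex ^ 'n \<Rightarrow> complex ^ 'n" where
  "sc \<equiv> reflection_ext coroot"

lemma C_simps [simp]:
  "C (u + v) w = C u w + C v w" "C (u - v) w = C u w - C v w" "C (c *s v) w = c * C v w"
  "C w (u + v) = C w u + C w v" "C w (u - v) = C w u - C w v" "C w (c *s v) = c * C w v"
  "C (- v) w = - C v w" "C w (- v) = - C w v"
  by (simp_all add: C_def bilinear_lneg[OF bilinear_B] bilinear_rneg[OF bilinear_B] form_ext_def complex_eq_iff algebra_simps)

lemma C_of_real: "C (of_real_vec v) (of_real_vec w) = of_real (B v w)"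
  by (simp add: C_def form_ext_def complex_eq_iff)

lemma C_commute: "C v w = C w v"
  by (simp add: C_def form_ext_def complex_eq_iff B_commute[of "Re_vec v"] B_commute[of "Im_vec v"])

lemma C_cv_nz: "\<alpha> \<in> \<Phi> \<Longrightarrow> C (cv \<alpha>) (cv \<alpha>) \<noteq> 0"
  using B_coroot_pos[of \<alpha>] by (simp add: cv_def C_of_real)

lemma functional_ext_eq:
  assumes "\<alpha> \<in> \<Phi>"
  shows "functional_ext \<alpha> v = 2 * C (cv \<alpha>) v / C (cv \<alpha>) (cv \<alpha>)"
proof -
  have "functional_ext \<alpha> v * C (cv \<alpha>) (cv \<alpha>) = 2 * C (cv \<alpha>) v"
    using root_eq_B[OF assms]
    by (simp add: functional_ext_def cv_def C_of_real complex_eq_iff) (simp add: C_def form_ext_def)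
  then show ?thesis using C_cv_nz[OF assms] by (simp add: field_simps)
qed

lemma sc_eq: "\<alpha> \<in> \<Phi> \<Longrightarrow> sc \<alpha> v = v - (2 * C (cv \<alpha>) v / C (cv \<alpha>) (cv \<alpha>)) *s cv \<alpha>"
  by (simp add: reflection_ext_def functional_ext_eq cv_def)

lemma C_sc: "\<alpha> \<in> \<Phi> \<Longrightarrow> C (sc \<alpha> v) (sc \<alpha> w) = C v w"
  using C_cv_nz[of \<alpha>] by (simp add: sc_eq C_commute[of v] field_simps)

lemma sc_sc: "\<alpha> \<in> \<Phi> \<Longrightarrow> sc \<alpha> (sc \<alpha> v) = v"
  using C_cv_nz[of \<alpha>] by (simp add: sc_eq vec_eq_iff field_simps)

lemma C_sc_left: "\<alpha> \<in> \<Phi> \<Longrightarrow> C (sc \<alpha> v) w = C v (sc \<alpha> w)"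
  using C_sc[of \<alpha> v "sc \<alpha> w"] by (simp add: sc_sc)

lemma cv_refl: "\<alpha> \<in> \<Phi> \<Longrightarrow> \<beta> \<in> \<Phi> \<Longrightarrow> cv (\<beta> \<circ> refl \<alpha>) = sc \<alpha> (cv \<beta>)"
  by (simp add: cv_def coroot_refl reflection_def reflection_ext_def of_real_vec_simps
      functional_ext_def complex_of_real_def)

text \<open>The coroots span the real space, hence their complexifications span the complex
  one.\<close>

lemma eq_0_if_eq_0_on_coroots:
  assumes "\<And>v w. f (v + w) = f v + f w" "\<And>c v. f (c *s v) = c * f v"
    "\<And>\<alpha>. \<alpha> \<in> \<Phi> \<Longrightarrow> f (cv \<alpha>) = (0::complex)"
  shows "f v = 0"
proof -
  have r: "f (of_real_vec x) = 0" for x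
  proof -
    have "x \<in> span (coroot ` \<Phi>)" by (simp add: span_coroots)
    then show ?thesis
    proof (induction x rule: span_induct_alt)
      case base
      show ?case using assms(2)[of 0 0] by (simp add: of_real_vec_simps)
    next
      case (step c x y)
      then show ?case using assms by (auto simp: of_real_vec_simps cv_def)
    qed
  qed
  show ?thesis by (subst complex_vec_decompose) (simp add: assms r)
qed

text \<open>Supplies the \<open>C\<close>-dual of the standard basis, which turns matrix
  coefficients into values of \<open>C\<close>.\<close>

lemma exists_coord_representer: "\<exists>z. \<forall>v. C v z = v $ j"
proof -
  have "linear (\<lambda>v :: real ^ 'n. v $ j)" by (simp add: linear_iff)
  from exists_representer[OF this] obtain z where "\<forall>v. v $ j = B z v" by blast
  then have "C v (of_real_vec z) = v $ j" for v
    by (simp add: C_def form_ext_def complex_eq_iff B_commute[of _ z] flip: Re_vec_def Im_vec_def)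
      (metis Re_vec_def Im_vec_def vec_lambda_beta)
  then show ?thesis by blast
qed

end

section \<open>The invariant form on bivectors\<close>

context irreducible_root_system
begin

definition D :: "complex ^ 'n \<Rightarrow> complex ^ 'n \<Rightarrow> complex ^ 'n \<Rightarrow> complex ^ 'n \<Rightarrow> complex" where
  "D u v p q = C u p * C v q - C u q * C v p"

lemma D_swap: "D u v p q = D p q u v"
  by (simp add: D_def C_commute[of u] C_commute[of v])

lemma D_simps [simp]:
  "D (u + u') v p q = D u v p q + D u' v p q" "D (u - u') v p q = D u v p q - D u' v p q"
  "D (c *s u) v p q = c * D u v p q" "D (- u) v p q = - D u v p q"
  "D u (v + v') p q = D u v p q + D u v' p q" "D u (v - v') p q = D u v p q - D u v' p q"
  "D u (c *s v) p q = c * D u v p q" "D u (- v) p q = - D u v p q"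
  "D u v (p + p') q = D u v p q + D u v p' q" "D u v (p - p') q = D u v p q - D u v p' q"
  "D u v (c *s p) q = c * D u v p q" "D u v (- p) q = - D u v p q"
  "D u v p (q + q') = D u v p q + D u v p q'" "D u v p (q - q') = D u v p q - D u v p q'"
  "D u v p (c *s q) = c * D u v p q" "D u v p (- q) = - D u v p q"
  "D u u p q = 0" "D u v p p = 0"
  by (simp_all add: D_def algebra_simps)

lemma D_sc: "\<gamma> \<in> \<Phi> \<Longrightarrow> D u v (sc \<gamma> p) (sc \<gamma> q) = D (sc \<gamma> u) (sc \<gamma> v) p q"
  by (simp add: D_def C_sc_left)

definition wt :: "(real ^ 'n \<Rightarrow> real) \<Rightarrow> complex" where
  "wt \<alpha> = k \<alpha> / (C (cv \<alpha>) (cv \<alpha>))\<^sup>2"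

text \<open>The square of a \<and> b, with the coefficient that remains after one factor
  \<open>C (cv \<alpha>) (cv \<beta>)\<close> is cancelled, read as a bilinear form on the bivectors
  u \<and> v and p \<and> q.\<close>

definition summand ::
  "complex ^ 'n \<Rightarrow> complex ^ 'n \<Rightarrow> complex ^ 'n \<Rightarrow> complex ^ 'n \<Rightarrow>
   (real ^ 'n \<Rightarrow> real) \<Rightarrow> (real ^ 'n \<Rightarrow> real) \<Rightarrow> complex" where
  "summand u v p q \<alpha> \<beta> =
     wt \<alpha> * wt \<beta> * C (cv \<alpha>) (cv \<beta>) * D (cv \<alpha>) (cv \<beta>) u v * D (cv \<alpha>) (cv \<beta>) p q"

lemma wt_refl: "\<alpha> \<in> \<Phi> \<Longrightarrow> \<beta> \<in> \<Phi> \<Longrightarrow> wt (\<beta> \<circ> refl \<alpha>) = wt \<beta>"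
  by (simp add: wt_def k_refl cv_refl C_sc)

lemma D_cv_sc: "\<alpha> \<in> \<Phi> \<Longrightarrow> D (cv \<alpha>) (sc \<alpha> v) p q = D (cv \<alpha>) v p q"
  by (simp add: sc_eq)

lemma sc_cv: "\<alpha> \<in> \<Phi> \<Longrightarrow> sc \<alpha> (cv \<alpha>) = (- 1) *s cv \<alpha>"
  using C_cv_nz[of \<alpha>] by (simp add: sc_eq vec_eq_iff)

lemma C_cv_sc: "\<alpha> \<in> \<Phi> \<Longrightarrow> C (cv \<alpha>) (sc \<alpha> v) = - C (cv \<alpha>) v"
  by (simp add: C_sc_left[symmetric] sc_cv)

lemma summand_simps:
  "summand (u + u') v p q \<alpha> \<beta> = summand u v p q \<alpha> \<beta> + summand u' v p q \<alpha> \<beta>"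
  "summand (u - u') v p q \<alpha> \<beta> = summand u v p q \<alpha> \<beta> - summand u' v p q \<alpha> \<beta>"
  "summand (c *s u) v p q \<alpha> \<beta> = c * summand u v p q \<alpha> \<beta>"
  "summand (- u) v p q \<alpha> \<beta> = - summand u v p q \<alpha> \<beta>"
  "summand u (v + v') p q \<alpha> \<beta> = summand u v p q \<alpha> \<beta> + summand u v' p q \<alpha> \<beta>"
  "summand u (v - v') p q \<alpha> \<beta> = summand u v p q \<alpha> \<beta> - summand u v' p q \<alpha> \<beta>"
  "summand u (c *s v) p q \<alpha> \<beta> = c * summand u v p q \<alpha> \<beta>"
  "summand u (- v) p q \<alpha> \<beta> = - summand u v p q \<alpha> \<beta>"
  "summand u v (p + p') q \<alpha> \<beta> = summand u v p q \<alpha> \<beta> + summand u v p' q \<alpha> \<beta>"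
  "summand u v (p - p') q \<alpha> \<beta> = summand u v p q \<alpha> \<beta> - summand u v p' q \<alpha> \<beta>"
  "summand u v (c *s p) q \<alpha> \<beta> = c * summand u v p q \<alpha> \<beta>"
  "summand u v (- p) q \<alpha> \<beta> = - summand u v p q \<alpha> \<beta>"
  "summand u v p (q + q') \<alpha> \<beta> = summand u v p q \<alpha> \<beta> + summand u v p q' \<alpha> \<beta>"
  "summand u v p (q - q') \<alpha> \<beta> = summand u v p q \<alpha> \<beta> - summand u v p q' \<alpha> \<beta>"
  "summand u v p (c *s q) \<alpha> \<beta> = c * summand u v p q \<alpha> \<beta>"
  "summand u v p (- q) \<alpha> \<beta> = - summand u v p q \<alpha> \<beta>"
  "summand u u p q \<alpha> \<beta> = 0"
  "summand u v p p \<alpha> \<beta> = 0"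
  by (simp_all add: summand_def algebra_simps)

lemma summand_commute: "summand u v p q \<alpha> \<beta> = summand u v p q \<beta> \<alpha>"
  by (simp add: summand_def D_def C_commute[of "cv \<beta>" "cv \<alpha>"]) (simp add: algebra_simps)

text \<open>The vector \<open>cv \<alpha>\<close> occurs three times, once in \<open>C\<close> and
  twice in \<open>D\<close>, and the weight is unchanged.\<close>

lemma summand_minus:
  "\<alpha> \<in> \<Phi> \<Longrightarrow> summand u v p q (\<lambda>v. - \<alpha> v) \<beta> = - summand u v p q \<alpha> \<beta>"
  by (simp add: summand_def minus_root cv_refl wt_refl sc_cv)

text \<open>The reflection changes b only by a multiple of a, so it keeps a \<and> b; it negates
  \<open>C (cv \<alpha>) (cv \<beta>)\<close>.\<close>

lemma summand_refl:
  "\<alpha> \<in> \<Phi> \<Longrightarrow> \<beta> \<in> \<Phi> \<Longrightarrow> summand u v p q \<alpha> (\<beta> \<circ> refl \<alpha>) = - summand u v p q \<alpha> \<beta>"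
  by (simp add: summand_def cv_refl wt_refl D_cv_sc C_cv_sc)

lemma summand_sc:
  "\<gamma> \<in> \<Phi> \<Longrightarrow> \<alpha> \<in> \<Phi> \<Longrightarrow> \<beta> \<in> \<Phi> \<Longrightarrow>
   summand (sc \<gamma> u) (sc \<gamma> v) (sc \<gamma> p) (sc \<gamma> q) \<alpha> \<beta> = summand u v p q (\<alpha> \<circ> refl \<gamma>) (\<beta> \<circ> refl \<gamma>)"
  by (simp add: summand_def cv_refl wt_refl D_sc C_sc)

end

section \<open>The form \<open>R\<close> and its invariance under reflections\<close>

locale positive_root_system = irreducible_root_system \<Phi> coroot B k
  for \<Phi> :: "(real ^ 'n \<Rightarrow> real) set"
    and coroot :: "(real ^ 'n \<Rightarrow> real) \<Rightarrow> real ^ 'n"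
    and B :: "real ^ 'n \<Rightarrow> real ^ 'n \<Rightarrow> real"
    and k :: "(real ^ 'n \<Rightarrow> real) \<Rightarrow> complex" +
  fixes x :: "real ^ 'n"
  assumes regular: "\<alpha> \<in> \<Phi> \<Longrightarrow> \<alpha> x \<noteq> 0"
begin

definition R :: "complex ^ 'n \<Rightarrow> complex ^ 'n \<Rightarrow> complex ^ 'n \<Rightarrow> complex ^ 'n \<Rightarrow> complex" where
  "R u v p q = (\<Sum>\<alpha>\<in>{\<alpha>\<in>\<Phi>. \<alpha> x > 0}. \<Sum>\<beta>\<in>{\<beta>\<in>\<Phi>. \<beta> x > 0}. summand u v p q \<alpha> \<beta>)"

text \<open>Moving the reflection from the arguments to the roots replaces the positive system of
  \<open>x\<close> by that of \<open>refl \<gamma> x\<close>, and the sum is the same for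
  both.\<close>

lemma R_sc:
  assumes g: "\<gamma> \<in> \<Phi>"
  shows "R (sc \<gamma> u) (sc \<gamma> v) (sc \<gamma> p) (sc \<gamma> q) = R u v p q"
proof -
  let ?P = "\<lambda>z. {\<alpha>\<in>\<Phi>. \<alpha> z > 0}"
  have re: "(\<Sum>\<alpha>\<in>?P x. h (\<alpha> \<circ> refl \<gamma>)) = (\<Sum>\<alpha>\<in>?P (refl \<gamma> x). h \<alpha>)" for h :: "_ \<Rightarrow> complex"
    by (rule sum.reindex_bij_witness[of _ "\<lambda>\<alpha>. \<alpha> \<circ> refl \<gamma>" "\<lambda>\<alpha>. \<alpha> \<circ> refl \<gamma>"])
      (use g in \<open>auto simp: root_refl fun_eq_iff\<close>)
  have "R (sc \<gamma> u) (sc \<gamma> v) (sc \<gamma> p) (sc \<gamma> q) =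
      (\<Sum>\<alpha>\<in>?P x. \<Sum>\<beta>\<in>?P x. summand u v p q (\<alpha> \<circ> refl \<gamma>) (\<beta> \<circ> refl \<gamma>))"
    unfolding R_def by (intro sum.cong refl) (auto simp: summand_sc g)
  also have "\<dots> = (\<Sum>\<alpha>\<in>?P x. \<Sum>\<beta>\<in>?P (refl \<gamma> x). summand u v p q (\<alpha> \<circ> refl \<gamma>) \<beta>)"
    by (intro sum.cong HOL.refl re)
  also have "\<dots> = (\<Sum>\<alpha>\<in>?P (refl \<gamma> x). \<Sum>\<beta>\<in>?P (refl \<gamma> x). summand u v p q \<alpha> \<beta>)"
    by (rule re)
  also have "\<dots> = R u v p q"
    unfolding R_def
  proof (rule sum_sum_positive_eq[where s = refl])
    show "\<alpha> (refl \<gamma> x) \<noteq> 0" if "\<alpha> \<in> \<Phi>" for \<alpha>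
      using regular[OF root_refl[OF g that]] by simp
    show "(\<lambda>v. - \<alpha> v) \<in> \<Phi>" if "\<alpha> \<in> \<Phi>" for \<alpha>
      by (simp add: minus_root root_refl that)
    show "refl \<alpha> v = v" if "\<alpha> v = 0" for \<alpha> v
      by (simp add: reflection_def that)
  qed (auto simp: finite_roots linear_root root_refl summand_minus summand_refl regular
      intro: summand_commute)
  finally show ?thesis .
qed

lemma R_simps [simp]:
  "R (u + u') v p q = R u v p q + R u' v p q" "R (u - u') v p q = R u v p q - R u' v p q"
  "R (c *s u) v p q = c * R u v p q" "R (- u) v p q = - R u v p q"
  "R u (v + v') p q = R u v p q + R u v' p q" "R u (v - v') p q = R u v p q - R u v' p q"
  "R u (c *s v) p q = c * R u v p q" "R u (- v) p q = - R u v p q"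
  "R u v (p + p') q = R u v p q + R u v p' q" "R u v (p - p') q = R u v p q - R u v p' q"
  "R u v (c *s p) q = c * R u v p q" "R u v (- p) q = - R u v p q"
  "R u v p (q + q') = R u v p q + R u v p q'" "R u v p (q - q') = R u v p q - R u v p q'"
  "R u v p (c *s q) = c * R u v p q" "R u v p (- q) = - R u v p q"
  "R u u p q = 0" "R u v p p = 0"
  by (simp_all add: R_def summand_simps sum.distrib sum_subtractf sum_negf sum_distrib_left)

lemma R_swap12: "R u v p q = - R v u p q"
  using R_simps(17)[of "u + v" p q] by (simp del: R_simps(17)) (simp add: eq_neg_iff_add_eq_0 add.commute)

lemma R_swap34: "R u v p q = - R u v q p"
  using R_simps(18)[of u v "p + q"] by (simp del: R_simps(18)) (simp add: eq_neg_iff_add_eq_0 add.commute)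

text \<open>\<open>R\<close> sees its first two arguments only through their pairings with bivectors
  of coroots.\<close>

lemma R_eq_0:
  assumes "\<And>p q. D u v p q = 0"
  shows "R u v p q = 0"
  using assms by (simp add: R_def summand_def D_swap[of _ _ u v])

section \<open>Bivectors of coroots as eigenvectors\<close>

definition par :: "(real ^ 'n \<Rightarrow> real) \<Rightarrow> (real ^ 'n \<Rightarrow> real) \<Rightarrow> bool" where
  "par \<alpha> \<beta> \<longleftrightarrow> (\<forall>p q. D (cv \<alpha>) (cv \<beta>) p q = 0)"

text \<open>\<open>par\<close> encodes a \<and> b = 0 through \<open>D\<close>, and equality in the
  Cauchy-Schwarz inequality for the definite form \<open>B\<close> forces linear dependence.\<close>

lemma not_par:
  assumes "\<not> par \<alpha> \<beta>"
  shows "C (cv \<alpha>) (cv \<alpha>) * C (cv \<beta>) (cv \<beta>) \<noteq> (C (cv \<alpha>) (cv \<beta>))\<^sup>2"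
proof
  let ?a = "coroot \<alpha>" and ?b = "coroot \<beta>"
  assume "C (cv \<alpha>) (cv \<alpha>) * C (cv \<beta>) (cv \<beta>) = (C (cv \<alpha>) (cv \<beta>))\<^sup>2"
  then have e: "B ?a ?a * B ?b ?b = B ?a ?b * B ?a ?b"
    by (simp add: cv_def C_of_real power2_eq_square flip: of_real_mult)
  \<comment> \<open>Up to the factor \<open>B ?a ?a\<close>, this is the component of b orthogonal
    to a.\<close>
  define d where "d = B ?a ?a *\<^sub>R ?b - B ?a ?b *\<^sub>R ?a"
  have "B d d = B ?a ?a * (B ?a ?a * B ?b ?b - B ?a ?b * B ?a ?b)"
    by (simp add: d_def B_commute[of ?b ?a] algebra_simps)
  then have "d = 0" using e B_pos[of d] by fastforce
  then have "B ?a ?a *\<^sub>R ?b = B ?a ?b *\<^sub>R ?a" by (simp add: d_def)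
  then have "of_real_vec (B ?a ?a *\<^sub>R ?b) = of_real_vec (B ?a ?b *\<^sub>R ?a)" by simp
  then have *: "of_real (B ?a ?a) *s cv \<beta> = of_real (B ?a ?b) *s cv \<alpha>"
    by (simp add: of_real_vec_simps cv_def)
  have "of_real (B ?a ?a) * D (cv \<alpha>) (cv \<beta>) p q = 0" for p q
    using D_simps(7)[of "cv \<alpha>" "of_real (B ?a ?a)" "cv \<beta>" p q] unfolding * by simp
  \<comment> \<open>The factor just obtained can only be cancelled if it is nonzero, so the case of
    a zero vector a is treated separately.\<close>
  moreover have "D (cv \<alpha>) (cv \<beta>) p q = 0" if "B ?a ?a = 0" for p q
  proof -
    have "?a = 0" using B_pos[of ?a] that by fastforce
    then show ?thesis using D_simps(3)[of 0 0 "cv \<beta>" p q] by (simp add: cv_def of_real_vec_simps)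
  qed
  ultimately show False using assms by (auto simp: par_def)
qed

text \<open>Since \<open>s\<^sub>\<alpha>\<close> negates \<open>a \<and> v\<close> for all \<open>v\<close>, the alternating form \<open>R(a,v,_,_)\<close> lies in \<open>a \<and> V\<close>.\<close>

lemma R_half:
  assumes a: "\<alpha> \<in> \<Phi>" and uv: "u = cv \<alpha> \<or> v = cv \<alpha>"
  shows "C (cv \<alpha>) (cv \<alpha>) * R u v p q = C (cv \<alpha>) q * R u v p (cv \<alpha>) - C (cv \<alpha>) p * R u v q (cv \<alpha>)"
proof -
  let ?a = "cv \<alpha>"
  have "R (sc \<alpha> u) (sc \<alpha> v) p' q' = - R u v p' q'" for p' q'
    using uv by (auto simp: sc_cv a) (simp_all add: sc_eq a)
  then have "R u v p q = - R u v (sc \<alpha> p) (sc \<alpha> q)"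
    using R_sc[OF a, of u v p q] by simp
  then have "2 * C ?a ?a * (C ?a ?a * R u v p q) =
      2 * C ?a ?a * (C ?a q * R u v p ?a - C ?a p * R u v q ?a)"
    using C_cv_nz[OF a] R_swap34[of u v ?a q] by (simp add: sc_eq a field_simps)
  then show ?thesis using C_cv_nz[OF a] by simp
qed

text \<open>By \<open>R_half\<close> the form \<open>R (cv \<alpha>) (cv \<beta>)\<close> lies in
  both a \<and> V and b \<and> V, which meet only in the line of a \<and> b when a and b are
  independent. The proof eliminates \<open>g\<close> from the two half identities.\<close>

lemma R_cv_eq_scaled_D:
  assumes a: "\<alpha> \<in> \<Phi>" and b: "\<beta> \<in> \<Phi>" and ab: "\<not> par \<alpha> \<beta>"
  shows "\<exists>l. \<forall>p q. R (cv \<alpha>) (cv \<beta>) p q = l * D (cv \<alpha>) (cv \<beta>) p q"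
proof -
  let ?a = "cv \<alpha>" and ?b = "cv \<beta>"
  define f where "f p = R ?a ?b p ?a" for p
  define g where "g p = R ?a ?b p ?b" for p
  define N where "N = C ?a ?a"
  define M where "M = C ?b ?b"
  define m where "m = C ?a ?b"
  define \<rho> where "\<rho> = f ?b"
  have N: "N \<noteq> 0" "M \<noteq> 0" using C_cv_nz a b by (auto simp: N_def M_def)
  have nz: "N * M - m * m \<noteq> 0" using not_par[OF ab] by (simp add: N_def M_def m_def power2_eq_square)
  have ga: "g ?a = - \<rho>" using R_swap34[of ?a ?b ?a ?b] by (simp add: g_def \<rho>_def f_def)
  have 1: "N * R ?a ?b p q = C ?a q * f p - C ?a p * f q" for p q
    using R_half[OF a, of ?a ?b p q] by (simp add: f_def N_def)
  have 2: "M * R ?a ?b p q = C ?b q * g p - C ?b p * g q" for p q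
    using R_half[OF b, of ?a ?b p q] by (simp add: g_def M_def)
  have 3: "M * f p = m * g p + \<rho> * C ?b p" for p
    using 2[of p ?a] ga by (simp add: f_def[symmetric] m_def C_commute[of ?b ?a] algebra_simps)
  have 4: "N * g p = m * f p - \<rho> * C ?a p" for p
    using 1[of p ?b] by (simp add: g_def[symmetric] m_def \<rho>_def algebra_simps)
  \<comment> \<open>\<open>N * M - m * m\<close> is the Gram determinant of a and b, nonzero by
    \<open>not_par\<close>.\<close>
  have 5: "(N * M - m * m) * f p = \<rho> * (N * C ?b p - m * C ?a p)" for p
  proof -
    have "N * (M * f p) = m * (N * g p) + N * \<rho> * C ?b p"
      unfolding 3 by (simp add: algebra_simps)
    then show ?thesis unfolding 4 by (simp add: algebra_simps)
  qed
  have "(N * M - m * m) * (N * R ?a ?b p q) = \<rho> * N * (C ?a q * C ?b p - C ?a p * C ?b q)" for p q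
  proof -
    have "(N * M - m * m) * (N * R ?a ?b p q) =
        C ?a q * ((N * M - m * m) * f p) - C ?a p * ((N * M - m * m) * f q)"
      unfolding 1 by (simp add: algebra_simps)
    then show ?thesis unfolding 5 by (simp add: algebra_simps)
  qed
  then have "R ?a ?b p q = (- \<rho> / (N * M - m * m)) * D ?a ?b p q" for p q
    using N nz by (simp add: D_def divide_simps) (simp add: algebra_simps)
  then show ?thesis by blast
qed

lemma R_cv_eq_scaled_D': "\<alpha> \<in> \<Phi> \<Longrightarrow> \<beta> \<in> \<Phi> \<Longrightarrow> \<exists>l. \<forall>p q. R (cv \<alpha>) (cv \<beta>) p q = l * D (cv \<alpha>) (cv \<beta>) p q"
  using R_cv_eq_scaled_D R_eq_0 by (cases "par \<alpha> \<beta>") (auto simp: par_def)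

text \<open>Says that u \<and> v is an eigenvector of the endomorphism relating \<open>R\<close> to
  \<open>D\<close>. When u \<and> v is zero this holds for every \<open>l\<close>.\<close>

definition eigen :: "complex \<Rightarrow> complex ^ 'n \<Rightarrow> complex ^ 'n \<Rightarrow> bool" where
  "eigen l u v \<longleftrightarrow> (\<forall>p q. R u v p q = l * D u v p q)"

text \<open>The reflection in \<beta> sends c to c - m b with m nonzero, so a \<and> c - m (a \<and>
  b) is an eigenvector too. Nonzero eigenvectors with different eigenvalues are independent and have
  no such combination as an eigenvector.\<close>

lemma eigen_nonorthogonal:
  assumes a: "\<alpha> \<in> \<Phi>" and b: "\<beta> \<in> \<Phi>" and c: "\<gamma> \<in> \<Phi>"
    and ab: "\<not> par \<alpha> \<beta>" and lb: "eigen l (cv \<alpha>) (cv \<beta>)" and bc: "C (cv \<beta>) (cv \<gamma>) \<noteq> 0"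
  shows "eigen l (cv \<alpha>) (cv \<gamma>)"
proof (rule ccontr)
  let ?a = "cv \<alpha>" and ?b = "cv \<beta>" and ?c = "cv \<gamma>"
  assume nl: "\<not> eigen l ?a ?c"
  define m where "m = 2 * C ?b ?c / C ?b ?b"
  have m: "m \<noteq> 0" using bc C_cv_nz[OF b] by (simp add: m_def)
  obtain lc where lc: "\<And>p q. R ?a ?c p q = lc * D ?a ?c p q"
    using R_cv_eq_scaled_D'[OF a c] by blast
  have lcl: "lc \<noteq> l" using nl lc by (auto simp: eigen_def)
  obtain ld where ld: "\<And>p q. R ?a (?c - m *s ?b) p q = ld * D ?a (?c - m *s ?b) p q"
    using R_cv_eq_scaled_D'[OF a root_refl[OF b c]] by (auto simp: cv_refl b c sc_eq m_def)
  have *: "(lc - ld) * D ?a ?c p q = m * (l - ld) * D ?a ?b p q" for p q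
    using ld[of p q] lb lc by (simp add: eigen_def algebra_simps)
  show False
  proof (cases "ld = l")
    case True
    then have "D ?a ?c p q = 0" for p q using *[of p q] lcl by simp
    then show False using nl R_eq_0[of ?a ?c] by (simp add: eigen_def)
  next
    case False
    define r where "r = (lc - ld) / (m * (l - ld))"
    have D: "D ?a ?b p q = r * D ?a ?c p q" for p q
      using *[of p q] False m by (simp add: r_def field_simps)
    \<comment> \<open>Here a \<and> b = r (a \<and> c), so the two eigenvalues coincide, against
      \<open>lcl\<close>.\<close>
    have "R ?a (?b - r *s ?c) p q = 0" for p q
      by (rule R_eq_0) (simp add: D)
    then have *: "R ?a ?b p q = r * R ?a ?c p q" for p q by simp
    have "l * D ?a ?b p q = lc * D ?a ?b p q" for p q
    proof -
      have "l * D ?a ?b p q = R ?a ?b p q" using lb by (simp add: eigen_def)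
      also have "\<dots> = lc * (r * D ?a ?c p q)" by (simp only: * lc mult.left_commute)
      finally show ?thesis by (simp only: D)
    qed
    then have "D ?a ?b p q = 0" for p q using lcl by (metis mult_cancel_right)
    then show False using ab by (simp add: par_def)
  qed
qed

section \<open>Irreducibility forces a single eigenvalue\<close>

lemma root_eq_0_iff: "\<alpha> \<in> \<Phi> \<Longrightarrow> \<alpha> (coroot \<beta>) = 0 \<longleftrightarrow> C (cv \<alpha>) (cv \<beta>) = 0"
  using root_eq_B[of \<alpha> "coroot \<beta>"] B_coroot_pos[of \<alpha>] by (auto simp: cv_def C_of_real)

text \<open>Irreducibility as connectedness: an edge of the non-orthogonality graph leaves every
  proper nonempty set of roots.\<close>

lemma not_partition:
  assumes "\<Phi>1 \<subseteq> \<Phi>" "\<Phi>1 \<noteq> {}" "\<Phi>1 \<noteq> \<Phi>"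
  shows "\<exists>\<beta>\<in>\<Phi>1. \<exists>\<gamma>\<in>\<Phi> - \<Phi>1. C (cv \<beta>) (cv \<gamma>) \<noteq> 0"
proof (rule ccontr)
  assume n: "\<not> ?thesis"
  have "\<alpha> (coroot \<beta>) = 0 \<and> \<beta> (coroot \<alpha>) = 0" if "\<alpha> \<in> \<Phi>1" "\<beta> \<in> \<Phi> - \<Phi>1" for \<alpha> \<beta>
  proof -
    have "C (cv \<alpha>) (cv \<beta>) = 0" using n that by blast
    moreover have "\<alpha> \<in> \<Phi>" "\<beta> \<in> \<Phi>" using that assms(1) by auto
    ultimately show ?thesis by (simp add: root_eq_0_iff C_commute[of "cv \<beta>" "cv \<alpha>"])
  qed
  then have "\<exists>\<Phi>1 \<Phi>2. \<Phi>1 \<noteq> {} \<and> \<Phi>2 \<noteq> {} \<and> \<Phi>1 \<union> \<Phi>2 = \<Phi> \<and> \<Phi>1 \<inter> \<Phi>2 = {} \<and>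
      (\<forall>\<alpha>\<in>\<Phi>1. \<forall>\<beta>\<in>\<Phi>2. \<alpha> (coroot \<beta>) = 0 \<and> \<beta> (coroot \<alpha>) = 0)"
    using assms by (intro exI[of _ \<Phi>1] exI[of _ "\<Phi> - \<Phi>1"] conjI) auto
  then show False using irreducible by (simp only: irreducible_roots_def not_True_eq_False simp_thms)
qed

text \<open>The reflection \<open>s\<^sub>\<alpha>\<close> does not change \<open>b\<close> modulo \<open>a\<close>.  Replacing \<open>b\<close> by \<open>s\<^sub>\<alpha>b\<close> therefore keeps the
  eigenvalue, and this circumvents chains of non-orthogonal roots that pass through \<open>\<alpha>\<close>.\<close>

lemma eigen_root:
  assumes a: "\<alpha> \<in> \<Phi>" and b: "\<beta> \<in> \<Phi>" and ab: "\<not> par \<alpha> \<beta>" and lb: "eigen l (cv \<alpha>) (cv \<beta>)"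
    and c: "\<gamma> \<in> \<Phi>"
  shows "eigen l (cv \<alpha>) (cv \<gamma>)"
proof -
  let ?G = "{\<beta>\<in>\<Phi>. \<not> par \<alpha> \<beta> \<and> eigen l (cv \<alpha>) (cv \<beta>)}"
  let ?U = "{\<beta>\<in>\<Phi>. eigen l (cv \<alpha>) (cv \<beta>)}"
  have "?U = \<Phi>"
  proof (rule ccontr)
    assume "?U \<noteq> \<Phi>"
    moreover have "?U \<noteq> {}" using b lb by auto
    ultimately obtain \<delta> \<gamma> where "\<delta> \<in> ?U" "\<gamma> \<in> \<Phi> - ?U" and dg: "C (cv \<delta>) (cv \<gamma>) \<noteq> 0"
      using not_partition[of ?U] by auto
    then have d: "\<delta> \<in> \<Phi>" "eigen l (cv \<alpha>) (cv \<delta>)" and g: "\<gamma> \<in> \<Phi>" "\<not> eigen l (cv \<alpha>) (cv \<gamma>)"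
      by auto
    \<comment> \<open>The eigenvalue passes along non-orthogonal roots unless the starting root is
      parallel to \<alpha>, so an edge leaving \<open>?U\<close> must start at such a root.\<close>
    have pd: "par \<alpha> \<delta>" using eigen_nonorthogonal[OF a d(1) g(1) _ d(2) dg] g(2) by blast
    have par_orth: "C (cv \<alpha>) v = 0 \<Longrightarrow> C (cv \<delta>) v = 0" for v
    proof -
      assume "C (cv \<alpha>) v = 0"
      moreover have "D (cv \<alpha>) (cv \<delta>) (cv \<alpha>) v = 0" using pd by (simp add: par_def)
      ultimately show ?thesis using C_cv_nz[OF a] by (simp add: D_def)
    qed
    have ag: "C (cv \<alpha>) (cv \<gamma>) \<noteq> 0" using par_orth dg by blast
    \<comment> \<open>Otherwise \<epsilon> and its reflection both lie in \<open>?G\<close>, and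
      \<gamma> is orthogonal to both. Their difference is a nonzero multiple of
      \<open>cv \<alpha>\<close>, contradicting \<open>ag\<close>.\<close>
    have orth: "C (cv \<alpha>) (cv \<epsilon>) = 0" if e: "\<epsilon> \<in> ?G" for \<epsilon>
    proof (rule ccontr)
      assume nz: "C (cv \<alpha>) (cv \<epsilon>) \<noteq> 0"
      have e1: "\<epsilon> \<circ> refl \<alpha> \<in> \<Phi>" "\<not> par \<alpha> (\<epsilon> \<circ> refl \<alpha>)" "eigen l (cv \<alpha>) (cv (\<epsilon> \<circ> refl \<alpha>))"
        using e a root_refl by (auto simp: par_def eigen_def cv_refl D_cv_sc) (simp add: sc_eq)
      have eg: "C (cv \<epsilon>) (cv \<gamma>) = 0"
        using eigen_nonorthogonal[OF a _ g(1), of \<epsilon>] e g(2) by blast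
      have "C (cv (\<epsilon> \<circ> refl \<alpha>)) (cv \<gamma>) \<noteq> 0"
        using e a nz ag eg C_cv_nz[OF a] by (simp add: cv_refl sc_eq)
      then show False using eigen_nonorthogonal[OF a e1(1) g(1) e1(2,3)] g(2) by blast
    qed
    \<comment> \<open>So \<open>?G\<close> is proper, and an edge leaves it towards some \<zeta>.
      The eigenvalue passes to \<zeta>, which must then be parallel to \<alpha>, although its
      neighbour \<epsilon> is orthogonal to \<alpha>.\<close>
    have "\<alpha> \<notin> ?G" by (simp add: par_def)
    then have "?G \<noteq> \<Phi>" using a by blast
    moreover have "?G \<noteq> {}" using b ab lb by auto
    ultimately obtain \<epsilon> \<zeta> where e: "\<epsilon> \<in> ?G" and "\<zeta> \<in> \<Phi> - ?G" and ez: "C (cv \<epsilon>) (cv \<zeta>) \<noteq> 0"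
      using not_partition[of ?G] by auto
    then have z: "\<zeta> \<in> \<Phi>" "\<zeta> \<notin> ?G" by auto
    have "eigen l (cv \<alpha>) (cv \<zeta>)" using eigen_nonorthogonal[OF a _ z(1) _ _ ez] e by blast
    then have "par \<alpha> \<zeta>" using z by blast
    moreover have "D (cv \<alpha>) (cv \<zeta>) (cv \<alpha>) (cv \<epsilon>) = C (cv \<alpha>) (cv \<alpha>) * C (cv \<zeta>) (cv \<epsilon>)"
      using orth[OF e] by (simp add: D_def)
    ultimately show False using ez C_cv_nz[OF a] by (simp add: par_def C_commute[of "cv \<zeta>"])
  qed
  then show ?thesis using c by blast
qed

text \<open>One independent pair \<alpha>, \<beta> fixes \<open>l\<close>. Every root \<gamma> is
  independent of \<alpha> or of \<beta>, so \<open>eigen_root\<close> carries \<open>l\<close> to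
  all pairs of roots, and linearity extends it to all vectors.\<close>

lemma R_eq_scaled_D: "\<exists>l. \<forall>u v p q. R u v p q = l * D u v p q"
proof -
  have "\<exists>l. \<forall>\<alpha>\<in>\<Phi>. \<forall>\<beta>\<in>\<Phi>. eigen l (cv \<alpha>) (cv \<beta>)"
  proof (cases "\<forall>\<alpha>\<in>\<Phi>. \<forall>\<beta>\<in>\<Phi>. par \<alpha> \<beta>")
    case True
    then show ?thesis using R_eq_0 by (auto simp: eigen_def par_def)
  next
    case False
    then obtain \<alpha> \<beta> where a: "\<alpha> \<in> \<Phi>" and b: "\<beta> \<in> \<Phi>" and ab: "\<not> par \<alpha> \<beta>" by blast
    from R_cv_eq_scaled_D[OF this] obtain l where l: "eigen l (cv \<alpha>) (cv \<beta>)" by (auto simp: eigen_def)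
    have swap: "D v u p q = - D u v p q" for u v p q by (simp add: D_def)
    have sym: "eigen l v u" if "eigen l u v" for u v
      unfolding eigen_def R_swap12[of v u] swap[of v u] using that by (simp add: eigen_def)
    have ba: "\<not> par \<beta> \<alpha>"
      using ab unfolding par_def swap[of "cv \<beta>" "cv \<alpha>"] by simp
    have "eigen l (cv \<gamma>) (cv \<delta>)" if c: "\<gamma> \<in> \<Phi>" and d: "\<delta> \<in> \<Phi>" for \<gamma> \<delta>
    proof (cases "par \<gamma> \<alpha>")
      case False
      show ?thesis by (rule eigen_root[OF c a False sym[OF eigen_root[OF a b ab l c]] d])
    next
      case ca: True
      have "\<not> par \<gamma> \<beta>"
      proof
        assume cb: "par \<gamma> \<beta>"
        have "C (cv \<gamma>) (cv \<gamma>) * C (cv \<delta>) q = C (cv \<gamma>) q * C (cv \<delta>) (cv \<gamma>)" if "par \<gamma> \<delta>" for \<delta> q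
          using that[unfolded par_def, rule_format, of "cv \<gamma>" q] by (simp add: D_def)
        note e = this[OF ca] this[OF cb]
        \<comment> \<open>If a and b are both multiples of \<open>cv \<gamma>\<close>, then a \<and>
          b = 0.\<close>
        have "(C (cv \<gamma>) (cv \<gamma>) * C (cv \<gamma>) (cv \<gamma>)) * D (cv \<alpha>) (cv \<beta>) p q = 0" for p q
        proof -
          have "(C (cv \<gamma>) (cv \<gamma>) * C (cv \<gamma>) (cv \<gamma>)) * D (cv \<alpha>) (cv \<beta>) p q =
            (C (cv \<gamma>) (cv \<gamma>) * C (cv \<alpha>) p) * (C (cv \<gamma>) (cv \<gamma>) * C (cv \<beta>) q) -
            (C (cv \<gamma>) (cv \<gamma>) * C (cv \<alpha>) q) * (C (cv \<gamma>) (cv \<gamma>) * C (cv \<beta>) p)"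
            by (simp add: D_def algebra_simps)
          then show ?thesis unfolding e(1)[of p] e(1)[of q] e(2)[of p] e(2)[of q] by (simp add: algebra_simps)
        qed
        then show False using ab C_cv_nz[OF c] by (simp add: par_def)
      qed
      then show ?thesis
        by (rule eigen_root[OF c b _ sym[OF eigen_root[OF b a ba sym[OF l] c]] d])
    qed
    then show ?thesis by blast
  qed
  then obtain l where l: "\<And>\<alpha> \<beta>. \<alpha> \<in> \<Phi> \<Longrightarrow> \<beta> \<in> \<Phi> \<Longrightarrow> eigen l (cv \<alpha>) (cv \<beta>)" by blast
  have 1: "R (cv \<alpha>) v p q - l * D (cv \<alpha>) v p q = 0" if "\<alpha> \<in> \<Phi>" for \<alpha> v p q
    using l[OF that]
    by (intro eq_0_if_eq_0_on_coroots[of "\<lambda>v. R (cv \<alpha>) v p q - l * D (cv \<alpha>) v p q" v])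
      (simp_all add: algebra_simps eigen_def)
  have "R u v p q - l * D u v p q = 0" for u v p q
    using 1
    by (intro eq_0_if_eq_0_on_coroots[of "\<lambda>u. R u v p q - l * D u v p q" u]) (simp_all add: algebra_simps)
  then have "R u v p q = l * D u v p q" for u v p q by simp
  then show ?thesis by blast
qed

end

section \<open>Action on the Weyl algebra\<close>

lemma weyl_scalar_add: "weyl_scalar (c + d) = weyl_scalar c + weyl_scalar d"
  by transfer (rule weyl_rel_eq, simp add: free_scalar_def single_add)

lemma weyl_scalar_mult: "weyl_scalar (c * d) = weyl_scalar c * weyl_scalar d"
  by transfer (rule weyl_rel_eq, simp add: free_scalar_def mult_single)

lemma weyl_scalar_0: "weyl_scalar 0 = 0"
  by transfer (rule weyl_rel_eq, simp add: free_scalar_def)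

lemma weyl_scalar_sum: "weyl_scalar (sum f A) = (\<Sum>a\<in>A. weyl_scalar (f a))"
  by (induction A rule: infinite_finite_induct) (simp_all add: weyl_scalar_0 weyl_scalar_add)

lemma weyl_scalar_commute: "x * weyl_scalar c = weyl_scalar c * x"
proof transfer
  fix p :: "'a phase fmon \<Rightarrow>\<^sub>0 complex" and c
  have "p * free_scalar c = free_scalar c * p"
    by (induction p rule: free_induct)
      (simp_all add: free_scalar_def mult_single distrib_left distrib_right mult.commute)
  then show "weyl_rel (p * free_scalar c) (free_scalar c * p)" by (rule weyl_rel_eq)
qed

lemma weyl_gen_add: "weyl_gen (u + u') = weyl_gen u + weyl_gen u'"
  by (simp add: weyl_gen_def plus_weyl.abs_eq weyl.abs_eq_iff weyl_rel_def weyl_ideal.add)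

lemma weyl_gen_scale: "weyl_gen (phase_scale c u) = weyl_scalar c * weyl_gen u"
  by (simp add: weyl_gen_def weyl_scalar.abs_eq times_weyl.abs_eq weyl.abs_eq_iff weyl_rel_def
      weyl_ideal.scale)

lemma weyl_gen_0: "weyl_gen 0 = 0"
  using weyl_gen_add[of 0 0] by simp

lemma weyl_gen_sum: "weyl_gen (sum f A) = (\<Sum>a\<in>A. weyl_gen (f a))"
  by (induction A rule: infinite_finite_induct) (simp_all add: weyl_gen_0 weyl_gen_add)

lemma cdual_scale_0: "cdual_scale c 0 = 0"
  by transfer simp

lemma cdual_comp_0: "cdual_comp 0 A = 0"
  by transfer simp

lemma cdual_apply_sum: "cdual_apply (sum f A) v = (\<Sum>a\<in>A. cdual_apply (f a) v)"
  by (induction A rule: infinite_finite_induct) (simp_all add: zero_cdual.rep_eq plus_cdual.rep_eq)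

lemma cdual_basis_expansion: "(\<Sum>i\<in>UNIV. cdual_scale (cdual_apply l (axis i 1)) (coord i)) = l"
proof (rule iffD1[OF cdual_apply_inject], rule ext)
  show "cdual_apply (\<Sum>i\<in>UNIV. cdual_scale (cdual_apply l (axis i 1)) (coord i)) v = cdual_apply l v" for v
    by (subst (2) cdual_expand) (simp add: cdual_apply_sum cdual_scale.rep_eq coord.rep_eq mult.commute)
qed

lemma weyl_gen_vec: "weyl_gen (v, 0) = (\<Sum>j\<in>UNIV. weyl_scalar (v $ j) * weyl_gen (axis j 1, 0))"
proof -
  have "(\<Sum>j\<in>UNIV. phase_scale (v $ j) (axis j 1, 0)) = (v, 0)"
    by (simp add: prod_eq_iff fst_sum snd_sum phase_scale_def basis_expansion cdual_scale_0)
  from arg_cong[OF this, of weyl_gen] show ?thesis by (simp add: weyl_gen_sum weyl_gen_scale)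
qed

lemma weyl_gen_cdual:
  "weyl_gen (0, l) = (\<Sum>i\<in>UNIV. weyl_scalar (cdual_apply l (axis i 1)) * weyl_gen (0, coord i))"
proof -
  have "(\<Sum>i\<in>UNIV. phase_scale (cdual_apply l (axis i 1)) (0, coord i)) = (0, l)"
    by (simp add: prod_eq_iff fst_sum snd_sum phase_scale_def cdual_basis_expansion)
  from arg_cong[OF this, of weyl_gen] show ?thesis by (simp add: weyl_gen_sum weyl_gen_scale)
qed

text \<open>The image under \<open>nu'\<close> of a matrix unit: the first index is the column, the
  second the row.\<close>

definition weyl_unit :: "('n :: finite) \<times> 'n \<Rightarrow> 'n weyl" where
  "weyl_unit p = weyl_gen (axis (snd p) 1, 0) * weyl_gen (0, coord (fst p))"

lemma nu'_expand:
  "nu' F = (\<Sum>p\<in>UNIV. weyl_scalar (F (axis (fst p) 1) $ snd p) * weyl_unit p)"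
proof -
  have "nu' F = (\<Sum>i\<in>UNIV. \<Sum>j\<in>UNIV. weyl_scalar (F (axis i 1) $ j) * weyl_unit (i, j))"
    unfolding nu'_def weyl_unit_def
    by (subst weyl_gen_vec) (simp add: sum_distrib_right mult.assoc)
  then show ?thesis by (simp add: sum.cartesian_product UNIV_Times_UNIV[symmetric] case_prod_beta del: UNIV_Times_UNIV)
qed

lemma weyl_act_sum: "invertible g \<Longrightarrow> weyl_act g (sum f A) = (\<Sum>a\<in>A. weyl_act g (f a))"
  using weyl_act_add[of g 0 0]
  by (induction A rule: infinite_finite_induct) (simp_all add: weyl_act_add)

text \<open>Equivariance of \<open>nu'\<close> under conjugation: the transformed dual basis is
  expanded in coordinates, and its coefficients are moved to the vector factor, where they
  reassemble \<open>g *v F (matrix_inv g *v v)\<close>.\<close>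

lemma weyl_act_nu':
  assumes g: "invertible g"
    and F: "\<And>v w. F (v + w) = F v + F w" "\<And>c v. F (c *s v) = c *s F v"
  shows "weyl_act g (nu' F) = nu' (\<lambda>v. g *v F (matrix_inv g *v v))"
proof -
  let ?h = "matrix_inv g" and ?e = "\<lambda>i. axis i (1::complex)"
  have F0: "F 0 = 0" using F(2)[of 0 0] by simp
  have F_sum: "F (sum f A) = (\<Sum>a\<in>A. F (f a))" for f :: "'a \<Rightarrow> _" and A
    by (induction A rule: infinite_finite_induct) (simp_all add: F F0)
  have g_sum: "g *v sum f A = (\<Sum>a\<in>A. g *v f a)" for f :: "'a \<Rightarrow> _" and A
    by (induction A rule: infinite_finite_induct) (simp_all add: matrix_vector_right_distrib)
  have "weyl_act g (nu' F) = (\<Sum>i\<in>UNIV. weyl_gen (g *v F (?e i), 0) * weyl_gen (0, cdual_comp (coord i) ?h))"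
    using g by (simp add: nu'_def weyl_act_sum weyl_act_mult weyl_act_gen phase_act_def cdual_comp_0)
  also have "\<dots> = (\<Sum>i\<in>UNIV. \<Sum>l\<in>UNIV. weyl_scalar ((?h *v ?e l) $ i) *
      (weyl_gen (g *v F (?e i), 0) * weyl_gen (0, coord l)))"
    by (subst weyl_gen_cdual) (simp add: sum_distrib_left cdual_comp.rep_eq coord.rep_eq
        weyl_scalar_commute mult.assoc[symmetric])
  also have "\<dots> = (\<Sum>l\<in>UNIV. (\<Sum>i\<in>UNIV. weyl_gen (phase_scale ((?h *v ?e l) $ i) (g *v F (?e i), 0))) *
      weyl_gen (0, coord l))"
    by (subst sum.swap) (simp add: sum_distrib_right weyl_gen_scale mult.assoc)
  also have "\<dots> = (\<Sum>l\<in>UNIV. weyl_gen (g *v F (?h *v ?e l), 0) * weyl_gen (0, coord l))"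
  proof (rule sum.cong)
    fix l
    have "(\<Sum>i\<in>UNIV. w $ i *s (g *v F (?e i))) = g *v F w" for w
    proof -
      have "g *v F w = g *v F (\<Sum>i\<in>UNIV. w $ i *s ?e i)" by (simp add: basis_expansion)
      also have "\<dots> = (\<Sum>i\<in>UNIV. w $ i *s (g *v F (?e i)))"
        by (simp add: F_sum F g_sum vector_scalar_commute)
      finally show ?thesis by simp
    qed
    then have "(\<Sum>i\<in>UNIV. phase_scale ((?h *v ?e l) $ i) (g *v F (?e i), 0)) = (g *v F (?h *v ?e l), 0)"
      by (simp add: prod_eq_iff fst_sum snd_sum phase_scale_def cdual_scale_0)
    then show "(\<Sum>i\<in>UNIV. weyl_gen (phase_scale ((?h *v ?e l) $ i) (g *v F (?e i), 0))) * weyl_gen (0, coord l)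
        = weyl_gen (g *v F (?h *v ?e l), 0) * weyl_gen (0, coord l)"
      by (simp flip: weyl_gen_sum)
  qed simp
  finally show ?thesis by (simp add: nu'_def)
qed

text \<open>Scalars are central, so a sum of squares depends only on the coefficient matrix of the
  products \<open>E p * E q\<close>, whose order is kept.\<close>

lemma weyl_sum_squares:
  fixes E :: "'p \<Rightarrow> ('n :: finite) weyl"
  shows "(\<Sum>a\<in>A. weyl_scalar (c a) * (\<Sum>p\<in>S. weyl_scalar (d a p) * E p)\<^sup>2) =
    (\<Sum>p\<in>S. \<Sum>q\<in>S. weyl_scalar (\<Sum>a\<in>A. c a * d a p * d a q) * (E p * E q))"
proof -
  have 1: "weyl_scalar s * (weyl_scalar t * y) = weyl_scalar (s * t) * y" for s t and y :: "'n weyl"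
    by (simp add: weyl_scalar_mult mult.assoc)
  have 2: "weyl_scalar s * x * (weyl_scalar t * y) = weyl_scalar (s * t) * (x * y)" for s t and x y :: "'n weyl"
    by (metis weyl_scalar_commute weyl_scalar_mult mult.assoc)
  have "weyl_scalar (c a) * (\<Sum>p\<in>S. weyl_scalar (d a p) * E p)\<^sup>2 =
      (\<Sum>p\<in>S. \<Sum>q\<in>S. weyl_scalar (c a * d a p * d a q) * (E p * E q))" for a
    by (simp only: power2_eq_square sum_product) (simp add: sum_distrib_left 1 2 mult.assoc[where 'a = complex])
  then have "(\<Sum>a\<in>A. weyl_scalar (c a) * (\<Sum>p\<in>S. weyl_scalar (d a p) * E p)\<^sup>2) =
      (\<Sum>a\<in>A. \<Sum>p\<in>S. \<Sum>q\<in>S. weyl_scalar (c a * d a p * d a q) * (E p * E q))" by simp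
  also have "\<dots> = (\<Sum>p\<in>S. \<Sum>a\<in>A. \<Sum>q\<in>S. weyl_scalar (c a * d a p * d a q) * (E p * E q))"
    by (rule sum.swap)
  also have "\<dots> = (\<Sum>p\<in>S. \<Sum>q\<in>S. \<Sum>a\<in>A. weyl_scalar (c a * d a p * d a q) * (E p * E q))"
    by (intro sum.cong refl sum.swap)
  finally show ?thesis by (simp add: weyl_scalar_sum sum_distrib_right)
qed

section \<open>Expansion of the element and orthogonal invariance\<close>

context positive_root_system
begin

text \<open>The terms linear in one reflection cancel, which leaves a multiple of a \<and> b acting
  as a skew endomorphism.\<close>

lemma commutator_sc:
  assumes a: "\<alpha> \<in> \<Phi>" and b: "\<beta> \<in> \<Phi>"
  shows "commutator (sc \<alpha>) (sc \<beta>) v =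
    (4 * C (cv \<alpha>) (cv \<beta>) / (C (cv \<alpha>) (cv \<alpha>) * C (cv \<beta>) (cv \<beta>))) *s
      (C (cv \<beta>) v *s cv \<alpha> - C (cv \<alpha>) v *s cv \<beta>)"
  using C_cv_nz[OF a] C_cv_nz[OF b]
  by (simp add: commutator_def sc_eq a b vec_eq_iff C_commute[of "cv \<beta>" "cv \<alpha>"] field_simps)

text \<open>Conjugation by an adjoint pair \<open>G\<close>, \<open>H\<close> is built in, so that
  one computation serves both the original element, with identities, and its image under an
  isometry.\<close>

lemma Omega_expand:
  assumes adj: "\<And>v w. C (G v) w = C v (H w)"
    and e: "\<And>j v. C v (e j) = v $ j"
  shows "weyl_scalar (1 / 16) * (\<Sum>\<alpha>\<in>{\<alpha>\<in>\<Phi>. \<alpha> x > 0}. \<Sum>\<beta>\<in>{\<beta>\<in>\<Phi>. \<beta> x > 0}.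
      weyl_scalar (k \<alpha> * k \<beta> * (1 / complex_of_real (B (coroot \<alpha>) (coroot \<beta>)))) *
      (nu' (\<lambda>v. G (commutator (sc \<alpha>) (sc \<beta>) (H v))))\<^sup>2) =
    (\<Sum>p\<in>UNIV. \<Sum>q\<in>UNIV. weyl_scalar (R (H (e (snd p))) (H (axis (fst p) 1)) (H (e (snd q))) (H (axis (fst q) 1))) *
      (weyl_unit p * weyl_unit q))"
proof -
  let ?P = "{\<alpha>\<in>\<Phi>. \<alpha> x > 0}"
  define d where "d \<alpha> \<beta> p = G (commutator (sc \<alpha>) (sc \<beta>) (H (axis (fst p) 1))) $ snd p" for \<alpha> \<beta> p
  define c where "c \<alpha> \<beta> = 1 / 16 * (k \<alpha> * k \<beta> * (1 / complex_of_real (B (coroot \<alpha>) (coroot \<beta>))))" for \<alpha> \<beta>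
  have d: "d \<alpha> \<beta> p = 4 * C (cv \<alpha>) (cv \<beta>) / (C (cv \<alpha>) (cv \<alpha>) * C (cv \<beta>) (cv \<beta>)) *
      D (cv \<alpha>) (cv \<beta>) (H (e (snd p))) (H (axis (fst p) 1))" if "\<alpha> \<in> \<Phi>" "\<beta> \<in> \<Phi>" for \<alpha> \<beta> p
    unfolding d_def e[symmetric] adj commutator_sc[OF that] by (simp add: D_def algebra_simps)
  \<comment> \<open>The squared factor 4 absorbs 1/16, and one
    \<open>C (cv \<alpha>) (cv \<beta>)\<close> cancels. For orthogonal coroots both sides are
    zero.\<close>
  have cdd: "c \<alpha> \<beta> * d \<alpha> \<beta> p * d \<alpha> \<beta> q =
      summand (H (e (snd p))) (H (axis (fst p) 1)) (H (e (snd q))) (H (axis (fst q) 1)) \<alpha> \<beta>"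
    if "\<alpha> \<in> \<Phi>" "\<beta> \<in> \<Phi>" for \<alpha> \<beta> p q
    by (cases "C (cv \<alpha>) (cv \<beta>) = 0")
      (simp_all add: d that c_def summand_def wt_def power2_eq_square C_of_real[symmetric] mult_ac flip: cv_def)
  have "weyl_scalar (1 / 16) * (\<Sum>\<alpha>\<in>?P. \<Sum>\<beta>\<in>?P.
      weyl_scalar (k \<alpha> * k \<beta> * (1 / complex_of_real (B (coroot \<alpha>) (coroot \<beta>)))) *
      (nu' (\<lambda>v. G (commutator (sc \<alpha>) (sc \<beta>) (H v))))\<^sup>2) =
    (\<Sum>(\<alpha>, \<beta>)\<in>?P \<times> ?P. weyl_scalar (c \<alpha> \<beta>) * (\<Sum>p\<in>UNIV. weyl_scalar (d \<alpha> \<beta> p) * weyl_unit p)\<^sup>2)"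
    unfolding sum.cartesian_product[symmetric] sum_distrib_left nu'_expand c_def weyl_scalar_mult d_def
    by (simp only: mult.assoc)
  also have "\<dots> = (\<Sum>p\<in>UNIV. \<Sum>q\<in>UNIV. weyl_scalar (\<Sum>(\<alpha>, \<beta>)\<in>?P \<times> ?P. c \<alpha> \<beta> * d \<alpha> \<beta> p * d \<alpha> \<beta> q) *
      (weyl_unit p * weyl_unit q))"
    unfolding case_prod_beta by (rule weyl_sum_squares)
  also have "\<dots> = (\<Sum>p\<in>UNIV. \<Sum>q\<in>UNIV. weyl_scalar (R (H (e (snd p))) (H (axis (fst p) 1)) (H (e (snd q))) (H (axis (fst q) 1))) *
      (weyl_unit p * weyl_unit q))"
    unfolding sum.cartesian_product[symmetric] R_def
    by (intro sum.cong refl arg_cong2[where f = "(*)"] arg_cong[where f = weyl_scalar]) (auto simp: cdd)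
  finally show ?thesis .
qed

text \<open>Both elements have coefficients given by \<open>R\<close>, with arguments moved by the
  inverse of \<open>g\<close> on one side. Since \<open>R\<close> is a multiple of \<open>D\<close>,
  which is built from \<open>C\<close>, the isometry leaves them unchanged.\<close>

lemma weyl_act_nu'_Omega':
  assumes g: "g \<in> orthogonal_group B"
  shows "weyl_act g (nu'_Omega' B coroot {\<alpha>\<in>\<Phi>. \<alpha> x > 0} k) = nu'_Omega' B coroot {\<alpha>\<in>\<Phi>. \<alpha> x > 0} k"
proof -
  let ?h = "matrix_inv g"
  have inv: "invertible g" and orth: "\<And>v w. C (g *v v) (g *v w) = C v w"
    using g by (auto simp: orthogonal_group_def C_def)
  have gh: "g *v (?h *v v) = v" for v
    using someI_ex[OF inv[unfolded invertible_def], folded matrix_inv_def]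
    by (simp add: matrix_vector_mul_assoc)
  \<comment> \<open>For an isometry the inverse is the \<open>C\<close>-adjoint, as
    \<open>Omega_expand\<close> requires.\<close>
  have adj: "C (g *v v) w = C v (?h *v w)" for v w
    using orth[of v "?h *v w"] by (simp add: gh)
  have hh: "C (?h *v v) (?h *v w) = C v w" for v w
    using orth[of "?h *v v" "?h *v w"] by (simp add: gh)
  obtain e where e: "\<And>j v. C v (e j) = v $ j" using exists_coord_representer by metis
  obtain l where l: "\<And>u v p q. R u v p q = l * D u v p q" using R_eq_scaled_D by blast
  have lin: "commutator (sc \<alpha>) (sc \<beta>) (v + w) = commutator (sc \<alpha>) (sc \<beta>) v + commutator (sc \<alpha>) (sc \<beta>) w"
    "commutator (sc \<alpha>) (sc \<beta>) (c *s v) = c *s commutator (sc \<alpha>) (sc \<beta>) v"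
    if "\<alpha> \<in> \<Phi>" "\<beta> \<in> \<Phi>" for \<alpha> \<beta> v w c
    unfolding commutator_sc[OF that] by (simp_all add: vec_eq_iff algebra_simps)
  have "weyl_act g (nu'_Omega' B coroot {\<alpha>\<in>\<Phi>. \<alpha> x > 0} k) =
    weyl_scalar (1 / 16) * (\<Sum>\<alpha>\<in>{\<alpha>\<in>\<Phi>. \<alpha> x > 0}. \<Sum>\<beta>\<in>{\<beta>\<in>\<Phi>. \<beta> x > 0}.
      weyl_scalar (k \<alpha> * k \<beta> * (1 / complex_of_real (B (coroot \<alpha>) (coroot \<beta>)))) *
      (nu' (\<lambda>v. g *v (commutator (sc \<alpha>) (sc \<beta>) (?h *v v))))\<^sup>2)"
    unfolding nu'_Omega'_def
    by (simp add: weyl_act_mult weyl_act_scalar weyl_act_sum inv power2_eq_square weyl_act_nu' lin cong: sum.cong_simp)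
  also have "\<dots> = nu'_Omega' B coroot {\<alpha>\<in>\<Phi>. \<alpha> x > 0} k"
    unfolding Omega_expand[of "\<lambda>v. g *v v" "\<lambda>v. ?h *v v" e, OF adj e] nu'_Omega'_def
      Omega_expand[of "\<lambda>v. v" "\<lambda>v. v" e, OF refl e]
    by (simp add: l D_def hh)
  finally show ?thesis .
qed

end

theorem proposition4p12:
  fixes \<Phi> P :: "(real ^ 'n \<Rightarrow> real) set"
    and coroot :: "(real ^ 'n \<Rightarrow> real) \<Rightarrow> real ^ 'n"
    and B :: "real ^ 'n \<Rightarrow> real ^ 'n \<Rightarrow> real"
    and k :: "(real ^ 'n \<Rightarrow> real) \<Rightarrow> complex"
  assumes "root_system \<Phi> coroot"
    and "finite (weyl_group \<Phi> coroot)"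
    and "irreducible_roots \<Phi> coroot"
    and "positive_system \<Phi> P"
    and "invariant_form \<Phi> coroot B"
    and "invariant_parameter \<Phi> coroot k"
  shows "\<forall>g\<in>orthogonal_group B. weyl_act g (nu'_Omega' B coroot P k) = nu'_Omega' B coroot P k"
proof -
  from assms(4) obtain x where x: "\<And>\<alpha>. \<alpha> \<in> \<Phi> \<Longrightarrow> \<alpha> x \<noteq> 0" and P: "P = {\<alpha>\<in>\<Phi>. \<alpha> x > 0}"
    unfolding positive_system_def by blast
  interpret positive_root_system \<Phi> coroot B k x
    by unfold_locales (use assms x in auto)
  show ?thesis
    unfolding P using weyl_act_nu'_Omega' by blast
qed

end
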